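(* The (deterministic) competitive ratio of the infinite server problem on layered graphs of depth $D$ is exactly $1.5$ for $D=2$, exactly $2.5$ for $D=3$, and at least $3$ for $D\ge4$. That is: for $D=2$ (resp. $D=3$) there is an online algorithm that is $1.5$-competitive (resp. $2.5$-competitive) on every layered graph of depth $D$, and for every $\rho$ smaller than $1.5$ (resp. $2.5$, resp. $3$ when $D\ge4$) there is a layered graph of depth $D$ on which no deterministic online algorithm is $\rho$-competitive.
   Context: A layered graph of depth $D$ is a graph whose (possibly infinitely many) nodes are arranged in layers $0,1,\dots,D$ such that all edges run between adjacent layers, layer $0$ consists of a single node, and every node other than that one is adjacent to at least one node of the previous layer. Its metric is the shortest-path (number of edges) distance; the node of layer $0$ is the source. Infinite server problem: an unbounded number of servers initially reside at the source; a finite sequence of requests (nodes) is revealed one by one; each must be served immediately, without knowledge of future requests, by moving a server to it; the cost is the total distance traveled. An online algorithm is $\rho$-competitive if $ALG(\sigma)\le\rho\,OPT(\sigma)+c$ for all request sequences $\sigma$, with $c$ independent of $\sigma$. *)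

theory Defs
  imports Complex_Main
begin

definition layered_graph ::
  "'v set \<Rightarrow> ('v \<Rightarrow> 'v \<Rightarrow> bool) \<Rightarrow> ('v \<Rightarrow> nat) \<Rightarrow> 'v \<Rightarrow> nat \<Rightarrow> bool" where
  "layered_graph V E lay s D \<longleftrightarrow>
     s \<in> V \<and> (\<forall>v\<in>V. lay v \<le> D) \<and> (\<forall>v\<in>V. lay v = 0 \<longleftrightarrow> v = s) \<and>
     (\<forall>u v. E u v \<longrightarrow> u \<in> V \<and> v \<in> V) \<and>
     (\<forall>u v. E u v \<longrightarrow> E v u) \<and>
     (\<forall>u v. E u v \<longrightarrow> lay v = lay u + 1 \<or> lay u = lay v + 1) \<and>
     (\<forall>v\<in>V. v \<noteq> s \<longrightarrow> (\<exists>u. E u v \<and> lay u + 1 = lay v))"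

definition gdist :: "('v \<Rightarrow> 'v \<Rightarrow> bool) \<Rightarrow> 'v \<Rightarrow> 'v \<Rightarrow> nat" where
  "gdist E u v = (LEAST n. \<exists>p. length p = Suc n \<and> hd p = u \<and> last p = v \<and>
                      (\<forall>i<n. E (p ! i) (p ! Suc i)))"

text \<open>Server configurations: servers are indexed by nat (unboundedly many);
all but finitely many servers are at the source.\<close>
definition valid_conf :: "'v set \<Rightarrow> 'v \<Rightarrow> (nat \<Rightarrow> 'v) \<Rightarrow> bool" where
  "valid_conf V s c \<longleftrightarrow> (\<forall>i. c i \<in> V) \<and> finite {i. c i \<noteq> s}"

definition move_cost :: "('v \<Rightarrow> 'v \<Rightarrow> bool) \<Rightarrow> (nat \<Rightarrow> 'v) \<Rightarrow> (nat \<Rightarrow> 'v) \<Rightarrow> nat" where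
  "move_cost E c c' = (\<Sum>i\<in>{i. c i \<noteq> c' i}. gdist E (c i) (c' i))"

text \<open>A deterministic online algorithm maps the sequence of requests seen so far to
the configuration after serving the last of them; the last request must be covered.\<close>
definition online_alg :: "'v set \<Rightarrow> 'v \<Rightarrow> ('v list \<Rightarrow> nat \<Rightarrow> 'v) \<Rightarrow> bool" where
  "online_alg V s alg \<longleftrightarrow>
     alg [] = (\<lambda>_. s) \<and>
     (\<forall>\<sigma>\<in>lists V. valid_conf V s (alg \<sigma>)) \<and>
     (\<forall>\<sigma> r. \<sigma> \<in> lists V \<longrightarrow> r \<in> V \<longrightarrow> r \<in> range (alg (\<sigma> @ [r])))"

definition alg_cost :: "('v \<Rightarrow> 'v \<Rightarrow> bool) \<Rightarrow> ('v list \<Rightarrow> nat \<Rightarrow> 'v) \<Rightarrow> 'v list \<Rightarrow> nat" where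
  "alg_cost E alg \<sigma> = (\<Sum>i<length \<sigma>. move_cost E (alg (take i \<sigma>)) (alg (take (Suc i) \<sigma>)))"

definition schedule :: "'v set \<Rightarrow> 'v \<Rightarrow> 'v list \<Rightarrow> (nat \<Rightarrow> 'v) list \<Rightarrow> bool" where
  "schedule V s \<sigma> cs \<longleftrightarrow>
     length cs = Suc (length \<sigma>) \<and> cs ! 0 = (\<lambda>_. s) \<and>
     (\<forall>c\<in>set cs. valid_conf V s c) \<and>
     (\<forall>i<length \<sigma>. \<sigma> ! i \<in> range (cs ! Suc i))"

definition sched_cost :: "('v \<Rightarrow> 'v \<Rightarrow> bool) \<Rightarrow> (nat \<Rightarrow> 'v) list \<Rightarrow> nat" where
  "sched_cost E cs = (\<Sum>i<length cs - 1. move_cost E (cs ! i) (cs ! Suc i))"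

definition opt_cost :: "'v set \<Rightarrow> ('v \<Rightarrow> 'v \<Rightarrow> bool) \<Rightarrow> 'v \<Rightarrow> 'v list \<Rightarrow> nat" where
  "opt_cost V E s \<sigma> = Inf {sched_cost E cs | cs. schedule V s \<sigma> cs}"

definition competitive ::
  "'v set \<Rightarrow> ('v \<Rightarrow> 'v \<Rightarrow> bool) \<Rightarrow> 'v \<Rightarrow> ('v list \<Rightarrow> nat \<Rightarrow> 'v) \<Rightarrow> real \<Rightarrow> bool" where
  "competitive V E s alg \<rho> \<longleftrightarrow>
     (\<exists>c::real. \<forall>\<sigma>\<in>lists V.
        real (alg_cost E alg \<sigma>) \<le> \<rho> * real (opt_cost V E s \<sigma>) + c)"

end

theory Submission
  imports Defs "HOL-Library.Countable"
begin

text \<open>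
Upper bounds: serve every new request by a fresh server from the source and never move it again.
The cost is the sum of the layers of the distinct requested nodes. An offline player pays at least
1 for each of them, and at least 2 for each one in layer \<open>D\<close>, because between two visits to layer
\<open>D\<close> a server has to step back. Hence the ratio is at most \<open>(D - 1) + 1/2\<close>.

Lower bounds, with \<open>D = \<delta> + 2\<close>: above a path of length \<open>\<delta>\<close> from the source put layers A and B.
The offline player holds one server on an active A-node \<open>u\<close> and \<open>N\<close> servers on a set \<open>T\<close> of B-nodes.
A step requests a fresh A-node \<open>a\<close> adjacent to all of \<open>T\<close>, then a fresh B-node adjacent to \<open>u\<close> and \<open>a\<close>,
then whichever of \<open>u\<close>, \<open>a\<close> the offline player kept; this costs the offline player 2. It is fixed only
after \<open>K\<close> steps which \<open>K\<close> nodes of \<open>T\<close> were vacated: they are chosen among those that the algorithm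
still covers, so that its servers there are wasted; if there are too few of them, the algorithm has
moved very many servers. The algorithm is charged through a 1-Lipschitz weight of server positions;
its cost minus the total weight grows by \<open>2 + (\<delta> + 1 - max 0 (\<delta> - 1)) + \<delta>\<close> per step, that is by
3, 5 and 6 for \<open>\<delta> = 0, 1, 2\<close>.
\<close>

section \<open>Distances and configurations\<close>

lemma gdist_relpowp: "gdist E u v = (LEAST n. (E ^^ n) u v)"
proof -
  have "(\<exists>p. length p = Suc n \<and> hd p = u \<and> last p = v \<and> (\<forall>i<n. E (p ! i) (p ! Suc i)))
        \<longleftrightarrow> (E ^^ n) u v" for n
  proof
    assume "\<exists>p. length p = Suc n \<and> hd p = u \<and> last p = v \<and> (\<forall>i<n. E (p ! i) (p ! Suc i))"
    then obtain p where p: "length p = Suc n" "hd p = u" "last p = v" "\<forall>i<n. E (p ! i) (p ! Suc i)"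
      by blast
    have "p \<noteq> []" using p(1) by auto
    then have "p ! 0 = u" "p ! n = v" using p by (auto simp: hd_conv_nth last_conv_nth)
    then show "(E ^^ n) u v" unfolding relpowp_fun_conv using p(4) by (intro exI[of _ "(!) p"]) auto
  next
    assume "(E ^^ n) u v"
    then obtain f where f: "f 0 = u" "f n = v" "\<forall>i<n. E (f i) (f (Suc i))"
      unfolding relpowp_fun_conv by blast
    show "\<exists>p. length p = Suc n \<and> hd p = u \<and> last p = v \<and> (\<forall>i<n. E (p ! i) (p ! Suc i))"
      by (rule exI[of _ "map f [0..<Suc n]"])
        (use f in \<open>auto simp: hd_map last_map hd_conv_nth nth_append simp del: upt_Suc\<close>)
  qed
  then show ?thesis unfolding gdist_def by simp
qed

lemma gdist_refl [simp]: "gdist E u u = 0"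
  unfolding gdist_relpowp by (rule Least_eq_0) simp

lemma gdist_le: "(E ^^ n) u v \<Longrightarrow> gdist E u v \<le> n"
  unfolding gdist_relpowp by (rule Least_le)

lemma move_cost_eq:
  assumes "finite I" "{i. c i \<noteq> c' i} \<subseteq> I"
  shows "move_cost E c c' = (\<Sum>i\<in>I. gdist E (c i) (c' i))"
  unfolding move_cost_def by (rule sum.mono_neutral_left) (use assms in auto)

lemma alg_cost_snoc:
  "alg_cost E alg (\<sigma> @ [r]) = alg_cost E alg \<sigma> + move_cost E (alg \<sigma>) (alg (\<sigma> @ [r]))"
  unfolding alg_cost_def by simp

lemma valid_conf_finite_neq:
  assumes "valid_conf V s c" "valid_conf V s c'"
  shows "finite ({i. c i \<noteq> s} \<union> {i. c' i \<noteq> s})" "{i. c i \<noteq> c' i} \<subseteq> {i. c i \<noteq> s} \<union> {i. c' i \<noteq> s}"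
  using assms by (auto simp: valid_conf_def)

lemma valid_conf_finite_range:
  assumes "valid_conf V s c" shows "finite (range c)"
proof -
  have "range c \<subseteq> insert s (c ` {i. c i \<noteq> s})" by auto
  moreover have "finite (insert s (c ` {i. c i \<noteq> s}))" using assms by (simp add: valid_conf_def)
  ultimately show ?thesis by (rule finite_subset)
qed

lemma online_algD:
  assumes "online_alg V s alg" "\<sigma> \<in> lists V"
  shows "valid_conf V s (alg \<sigma>)" "r \<in> V \<Longrightarrow> r \<in> range (alg (\<sigma> @ [r]))"
  using assms unfolding online_alg_def by blast+

section \<open>Walks and distances in a layered graph\<close>

locale layered =
  fixes V :: "'v set" and E lay s D
  assumes lg: "layered_graph V E lay s D"
begin

lemma s_in [simp]: "s \<in> V" and lay_s [simp]: "lay s = 0"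
  and lay_le: "v \<in> V \<Longrightarrow> lay v \<le> D"
  and lay_0: "v \<in> V \<Longrightarrow> lay v = 0 \<longleftrightarrow> v = s"
  and E_in: "E u v \<Longrightarrow> u \<in> V" "E u v \<Longrightarrow> v \<in> V"
  and E_sym: "E u v \<Longrightarrow> E v u"
  and E_lay: "E u v \<Longrightarrow> lay v = lay u + 1 \<or> lay u = lay v + 1"
  and parent: "v \<in> V \<Longrightarrow> v \<noteq> s \<Longrightarrow> \<exists>u. E u v \<and> lay u + 1 = lay v"
  using lg unfolding layered_graph_def by (simp_all del: One_nat_def)

lemma walk_from_source: "v \<in> V \<Longrightarrow> (E ^^ lay v) s v"
proof (induction "lay v" arbitrary: v)
  case 0
  then show ?case using lay_0[of v] by auto
next
  case (Suc n)
  then obtain u where u: "E u v" "lay u + 1 = lay v" using parent[of v] by fastforce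
  then have "(E ^^ lay u) s u" using Suc E_in by auto
  then have "(E ^^ Suc (lay u)) s v" using u(1) by auto
  then show ?case using u(2) by (metis Suc_eq_plus1)
qed

lemma walk_sym: "(E ^^ n) u v \<Longrightarrow> (E ^^ n) v u"
proof (induction n arbitrary: v)
  case (Suc n)
  then obtain w where "(E ^^ n) u w" "E w v" by auto
  then have "E v w" "(E ^^ n) w u" using Suc E_sym by auto
  then show ?case by (rule relpowp_Suc_I2)
qed simp

text \<open>Any two nodes are joined by a walk through the source, so the \<open>LEAST\<close> in
  \<open>gdist\<close> is attained; for unconnected nodes its value would be unspecified.\<close>

lemma walk_gdist:
  assumes "u \<in> V" "v \<in> V"
  shows "(E ^^ gdist E u v) u v"
proof -
  have "(E ^^ (lay u + lay v)) u v"
    unfolding relpowp_add using walk_sym walk_from_source assms by blast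
  then show ?thesis unfolding gdist_relpowp by (rule LeastI)
qed

text \<open>A function that rises by at most 1 along every edge certifies a lower bound on
  distances. The layer number, the weight \<open>wt\<close> and its modification
  \<open>\<psi>\<close> are used in this way.\<close>

lemma gdist_lipschitz:
  fixes \<phi> :: "'v \<Rightarrow> int"
  assumes "u \<in> V" "v \<in> V" and lip: "\<And>x y. E x y \<Longrightarrow> \<phi> y \<le> \<phi> x + 1"
  shows "\<phi> v - \<phi> u \<le> int (gdist E u v)"
proof -
  have "(E ^^ n) u w \<Longrightarrow> \<phi> w \<le> \<phi> u + int n" for n w
  proof (induction n arbitrary: w)
    case (Suc n)
    then obtain z where "(E ^^ n) u z" "E z w" by auto
    then show ?case using Suc.IH[of z] lip[of z w] by simp
  qed auto
  from this[OF walk_gdist[OF assms(1,2)]] show ?thesis by simp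
qed

lemma gdist_source_le: "v \<in> V \<Longrightarrow> gdist E s v \<le> lay v"
  by (intro gdist_le walk_from_source)

lemma gdist_edge: "E u v \<Longrightarrow> gdist E u v \<le> 1"
  by (intro gdist_le) auto

lemma gdist_ge_1: "u \<in> V \<Longrightarrow> v \<in> V \<Longrightarrow> u \<noteq> v \<Longrightarrow> gdist E u v \<ge> 1"
  using walk_gdist[of u v] by (cases "gdist E u v") auto

lemma gdist_ge_2:
  assumes "u \<in> V" "v \<in> V" "u \<noteq> v" "lay u = lay v"
  shows "gdist E u v \<ge> 2"
proof -
  have "gdist E u v \<noteq> 1"
  proof
    assume "gdist E u v = 1"
    then have "E u v" using walk_gdist[OF assms(1,2)] by (metis relpowp_1)
    then show False using E_lay assms(4) by fastforce
  qed
  then show ?thesis using gdist_ge_1[OF assms(1-3)] by simp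
qed

lemma gdist_ge_lay: "u \<in> V \<Longrightarrow> v \<in> V \<Longrightarrow> int (lay v) - int (lay u) \<le> int (gdist E u v)"
  by (rule gdist_lipschitz) (use E_lay in force)+

text \<open>An amortized bound with \<open>\<phi>\<close> as credit on server positions: each newly
  covered node of \<open>B\<close> has its own server that moved onto it and can be charged
  \<open>\<kappa>\<close>. As \<open>\<phi> s = 0\<close>, servers at the source do not contribute
  and the sums stay finite.\<close>

lemma move_cost_ge_new:
  fixes \<phi> :: "'v \<Rightarrow> nat"
  assumes c: "valid_conf V s c" "valid_conf V s c'" and "\<phi> s = 0"
    and dist: "\<And>p q. p \<in> V \<Longrightarrow> q \<in> V \<Longrightarrow> p \<noteq> q \<Longrightarrow>
                 (if q \<in> B then \<kappa> else 0) + \<phi> q \<le> gdist E p q + \<phi> p"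
  shows "\<kappa> * card ((range c' - range c) \<inter> B) + (\<Sum>i | c' i \<noteq> s. \<phi> (c' i))
         \<le> move_cost E c c' + (\<Sum>i | c i \<noteq> s. \<phi> (c i))"
proof -
  define I where "I = {i. c i \<noteq> s} \<union> {i. c' i \<noteq> s}"
  note fin = valid_conf_finite_neq[OF c, folded I_def]
  define J where "J = {i\<in>I. c i \<noteq> c' i \<and> c' i \<in> B}"
  have "(range c' - range c) \<inter> B \<subseteq> c' ` J"
  proof
    fix p assume p: "p \<in> (range c' - range c) \<inter> B"
    then obtain i where "p = c' i" by auto
    moreover from this have "c i \<noteq> c' i" using p by (metis DiffD2 IntD1 rangeI)
    ultimately have "i \<in> J" using p fin(2) unfolding J_def by auto
    then show "p \<in> c' ` J" using \<open>p = c' i\<close> by blast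
  qed
  moreover have "finite J" using fin by (simp add: J_def)
  ultimately have "card ((range c' - range c) \<inter> B) \<le> card J"
    by (meson card_image_le card_mono finite_imageI le_trans)
  then have "\<kappa> * card ((range c' - range c) \<inter> B) \<le> (\<Sum>i\<in>J. \<kappa>)" by (simp add: mult.commute)
  also have "\<dots> = (\<Sum>i\<in>I. if c i \<noteq> c' i \<and> c' i \<in> B then \<kappa> else 0)"
    unfolding J_def by (rule sum.inter_filter) (rule fin)
  finally have "\<kappa> * card ((range c' - range c) \<inter> B) + (\<Sum>i\<in>I. \<phi> (c' i))
      \<le> (\<Sum>i\<in>I. (if c i \<noteq> c' i \<and> c' i \<in> B then \<kappa> else 0) + \<phi> (c' i))"
    by (simp add: sum.distrib)
  also have "\<dots> \<le> (\<Sum>i\<in>I. gdist E (c i) (c' i) + \<phi> (c i))"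
  proof (rule sum_mono)
    fix i
    show "(if c i \<noteq> c' i \<and> c' i \<in> B then \<kappa> else 0) + \<phi> (c' i) \<le> gdist E (c i) (c' i) + \<phi> (c i)"
      using dist[of "c i" "c' i"] c by (cases "c i = c' i") (auto simp: valid_conf_def)
  qed
  also have "\<dots> = move_cost E c c' + (\<Sum>i\<in>I. \<phi> (c i))"
    by (simp add: sum.distrib move_cost_eq[OF fin])
  finally have "\<kappa> * card ((range c' - range c) \<inter> B) + (\<Sum>i\<in>I. \<phi> (c' i))
      \<le> move_cost E c c' + (\<Sum>i\<in>I. \<phi> (c i))" .
  moreover have "(\<Sum>i\<in>I. \<phi> (c' i)) = (\<Sum>i | c' i \<noteq> s. \<phi> (c' i))"
    by (rule sum.mono_neutral_right) (use fin \<open>\<phi> s = 0\<close> in \<open>auto simp: I_def\<close>)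
  moreover have "(\<Sum>i\<in>I. \<phi> (c i)) = (\<Sum>i | c i \<noteq> s. \<phi> (c i))"
    by (rule sum.mono_neutral_right) (use fin \<open>\<phi> s = 0\<close> in \<open>auto simp: I_def\<close>)
  ultimately show ?thesis by simp
qed

text \<open>Summed over a schedule, the credit telescopes: it starts at 0 and ends nonnegative. The
  source is covered at the start for free, hence \<open>s \<notin> B\<close>.\<close>

lemma sched_cost_ge:
  fixes \<phi> :: "'v \<Rightarrow> nat"
  assumes cs: "schedule V s \<sigma> cs" and "\<phi> s = 0" "s \<notin> B"
    and dist: "\<And>p q. p \<in> V \<Longrightarrow> q \<in> V \<Longrightarrow> p \<noteq> q \<Longrightarrow>
                 (if q \<in> B then \<kappa> else 0) + \<phi> q \<le> gdist E p q + \<phi> p"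
  shows "\<kappa> * card (set \<sigma> \<inter> B) \<le> sched_cost E cs"
proof -
  \<comment> \<open>Nodes are counted when they are covered for the first time; this count grows in
    a move by at most the number of newly covered nodes.\<close>
  define vis where "vis k = (\<Union>j\<le>k. range (cs ! j))" for k
  have len: "length cs = Suc (length \<sigma>)" and c0: "cs ! 0 = (\<lambda>_. s)"
    and val: "\<And>k. k \<le> length \<sigma> \<Longrightarrow> valid_conf V s (cs ! k)"
    and srv: "\<And>i. i < length \<sigma> \<Longrightarrow> \<sigma> ! i \<in> range (cs ! Suc i)"
    using cs unfolding schedule_def by auto
  have finvis: "k \<le> length \<sigma> \<Longrightarrow> finite (vis k)" for k
    unfolding vis_def by (intro finite_UN_I finite_atMost valid_conf_finite_range[OF val]) simp
  have "k \<le> length \<sigma> \<Longrightarrow> \<kappa> * card (vis k \<inter> B) + (\<Sum>i | (cs ! k) i \<noteq> s. \<phi> ((cs ! k) i))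
      \<le> (\<Sum>i<k. move_cost E (cs ! i) (cs ! Suc i))" for k
  proof (induction k)
    case 0
    have "vis 0 \<inter> B = {}" using \<open>s \<notin> B\<close> by (auto simp: vis_def c0)
    then show ?case by (simp add: c0)
  next
    case (Suc k)
    let ?N = "(range (cs ! Suc k) - range (cs ! k)) \<inter> B"
    have "vis (Suc k) \<inter> B \<subseteq> (vis k \<inter> B) \<union> ?N"
      by (auto simp: vis_def atMost_Suc)
    moreover have "finite ?N" using valid_conf_finite_range[OF val[OF Suc.prems]] by simp
    ultimately have "card (vis (Suc k) \<inter> B) \<le> card ((vis k \<inter> B) \<union> ?N)"
      using finvis[of k] Suc.prems by (intro card_mono) auto
    also have "\<dots> \<le> card (vis k \<inter> B) + card ?N" by (rule card_Un_le)
    finally have "\<kappa> * card (vis (Suc k) \<inter> B) \<le> \<kappa> * card (vis k \<inter> B) + \<kappa> * card ?N"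
      by (metis add_mult_distrib2 mult_le_mono2)
    then show ?case
      using Suc.IH Suc.prems move_cost_ge_new[OF val[of k] val[of "Suc k"] \<open>\<phi> s = 0\<close> dist]
      by simp
  qed
  from this[of "length \<sigma>"]
  have "\<kappa> * card (vis (length \<sigma>) \<inter> B) \<le> sched_cost E cs"
    unfolding sched_cost_def len by simp
  moreover have "set \<sigma> \<inter> B \<subseteq> vis (length \<sigma>) \<inter> B"
  proof
    fix x assume x: "x \<in> set \<sigma> \<inter> B"
    then obtain i where "i < length \<sigma>" "x = \<sigma> ! i" by (auto simp: in_set_conv_nth)
    then have "x \<in> range (cs ! Suc i)" "Suc i \<le> length \<sigma>" using srv by auto
    then show "x \<in> vis (length \<sigma>) \<inter> B" using x unfolding vis_def by blast
  qed
  then have "\<kappa> * card (set \<sigma> \<inter> B) \<le> \<kappa> * card (vis (length \<sigma>) \<inter> B)"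
    using finvis[of "length \<sigma>"] by (intro mult_le_mono2 card_mono) auto
  ultimately show ?thesis by (rule le_trans[rotated])
qed

end

section \<open>The upper bounds\<close>

text \<open>The server index is the position of the request in the sequence. Thus the configuration
  is a function of the requests alone, and appending a request can affect only the server with the
  new index.\<close>

definition fresh_alg :: "'v \<Rightarrow> 'v list \<Rightarrow> nat \<Rightarrow> 'v" where
  "fresh_alg s \<sigma> i = (if i < length \<sigma> \<and> \<sigma> ! i \<notin> set (take i \<sigma>) then \<sigma> ! i else s)"

lemma fresh_alg_range: "r \<in> set \<sigma> \<Longrightarrow> r \<in> range (fresh_alg s \<sigma>)"
proof -
  assume "r \<in> set \<sigma>"
  then obtain xs ys where "\<sigma> = xs @ r # ys" "r \<notin> set xs" by (meson split_list_first)
  then have "fresh_alg s \<sigma> (length xs) = r" by (simp add: fresh_alg_def)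
  then show ?thesis by (metis rangeI)
qed

context layered
begin

lemma online_fresh_alg: "online_alg V s (fresh_alg s)"
proof -
  have "valid_conf V s (fresh_alg s \<sigma>)" if "\<sigma> \<in> lists V" for \<sigma>
  proof -
    have "{i. fresh_alg s \<sigma> i \<noteq> s} \<subseteq> {..<length \<sigma>}" by (auto simp: fresh_alg_def split: if_splits)
    then show ?thesis using that finite_subset
      by (fastforce simp: valid_conf_def fresh_alg_def in_lists_conv_set)
  qed
  moreover have "fresh_alg s [] = (\<lambda>_. s)" by (simp add: fresh_alg_def fun_eq_iff)
  moreover have "r \<in> range (fresh_alg s (\<sigma> @ [r]))" for \<sigma> r by (rule fresh_alg_range) simp
  ultimately show ?thesis unfolding online_alg_def by blast
qed

lemma fresh_alg_cost: "\<sigma> \<in> lists V \<Longrightarrow> alg_cost E (fresh_alg s) \<sigma> \<le> (\<Sum>x\<in>set \<sigma>. lay x)"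
proof (induction \<sigma> rule: rev_induct)
  case (snoc r \<sigma>)
  have *: "fresh_alg s (\<sigma> @ [r]) i = (if i = length \<sigma> \<and> r \<notin> set \<sigma> then r else fresh_alg s \<sigma> i)" for i
    by (auto simp: fresh_alg_def nth_append)
  have "move_cost E (fresh_alg s \<sigma>) (fresh_alg s (\<sigma> @ [r]))
      = (\<Sum>i\<in>{length \<sigma>}. gdist E (fresh_alg s \<sigma> i) (fresh_alg s (\<sigma> @ [r]) i))"
    by (rule move_cost_eq) (auto simp: *)
  also have "\<dots> \<le> (if r \<in> set \<sigma> then 0 else lay r)"
    using gdist_source_le[of r] snoc.prems by (auto simp: *) (simp add: fresh_alg_def)
  finally show ?case using snoc
    by (cases "r \<in> set \<sigma>") (auto simp: alg_cost_snoc insert_absorb)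
qed (simp add: alg_cost_def)

lemma fresh_alg_competitive:
  assumes "D \<ge> 2"
  shows "competitive V E s (fresh_alg s) (real (2 * D - 1) / 2)"
proof -
  have "2 * alg_cost E (fresh_alg s) \<sigma> \<le> (2 * D - 1) * opt_cost V E s \<sigma>" if \<sigma>: "\<sigma> \<in> lists V" for \<sigma>
  proof -
    define B where "B = {v \<in> V. lay v = D}"
    \<comment> \<open>The run of the algorithm shows that a schedule exists, so the infimum in
      \<open>opt_cost\<close> is attained by some \<open>cs\<close>.\<close>
    have "schedule V s \<sigma> (map (\<lambda>i. fresh_alg s (take i \<sigma>)) [0..<Suc (length \<sigma>)])"
      unfolding schedule_def
    proof (intro conjI ballI allI impI)
      fix c assume "c \<in> set (map (\<lambda>i. fresh_alg s (take i \<sigma>)) [0..<Suc (length \<sigma>)])"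
      then obtain i where "c = fresh_alg s (take i \<sigma>)" unfolding set_map by blast
      moreover have "take i \<sigma> \<in> lists V" using \<sigma> by (auto dest: in_set_takeD)
      ultimately show "valid_conf V s c" using online_algD(1)[OF online_fresh_alg] by simp
    next
      fix i assume i: "i < length \<sigma>"
      have "\<sigma> ! i \<in> range (fresh_alg s (take (Suc i) \<sigma>))"
        by (rule fresh_alg_range) (simp add: i take_Suc_conv_app_nth)
      then show "\<sigma> ! i \<in> range (map (\<lambda>i. fresh_alg s (take i \<sigma>)) [0..<Suc (length \<sigma>)] ! Suc i)"
        using i by (simp del: upt_Suc)
    qed (simp_all del: upt_Suc add: fresh_alg_def fun_eq_iff)
    then have "opt_cost V E s \<sigma> \<in> {sched_cost E cs | cs. schedule V s \<sigma> cs}"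
      unfolding opt_cost_def by (intro Inf_nat_def1) auto
    then obtain cs where cs: "schedule V s \<sigma> cs" "opt_cost V E s \<sigma> = sched_cost E cs" by auto
    have 1: "1 * card (set \<sigma> \<inter> (V - {s})) \<le> sched_cost E cs"
      by (rule sched_cost_ge[where \<phi> = "\<lambda>_. 0", OF cs(1)]) (use gdist_ge_1 in auto)
    have 2: "2 * card (set \<sigma> \<inter> B) \<le> sched_cost E cs"
    \<comment> \<open>Layer \<open>D\<close> is at distance at least 2 from other nodes outside
      layer \<open>D - 1\<close>. From layer \<open>D - 1\<close> the step may cost only 1, but it
      spends a credit of 1 that was paid on arrival there. \<open>D \<ge> 2\<close> keeps the credit
      of the source at 0.\<close>
    proof (rule sched_cost_ge[where \<phi> = "\<lambda>v. if lay v = D - 1 then 1 else 0", OF cs(1)])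
      show "(if q \<in> B then 2 else 0) + (if lay q = D - 1 then 1 else 0)
          \<le> gdist E p q + (if lay p = D - 1 then 1 else 0)"
        if "p \<in> V" "q \<in> V" "p \<noteq> q" for p q
      proof -
        have "lay p \<le> D" using that lay_le by simp
        then have "2 \<le> gdist E p q" if "lay q = D" "lay p \<noteq> D - 1"
          using gdist_ge_2[of p q] gdist_ge_lay[of p q] that \<open>p \<in> V\<close> \<open>q \<in> V\<close> \<open>p \<noteq> q\<close>
          by (cases "lay p = D") (simp, linarith)
        then show ?thesis using gdist_ge_1[OF that] \<open>D \<ge> 2\<close> by (auto simp: B_def)
      qed
    qed (use assms in \<open>auto simp: B_def\<close>)
    have "(\<Sum>x\<in>set \<sigma>. lay x) \<le> (\<Sum>x\<in>set \<sigma>. (if x \<in> V - {s} then D - 1 else 0) + (if x \<in> B then 1 else 0))"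
    proof (rule sum_mono)
      fix x assume "x \<in> set \<sigma>"
      then have "x \<in> V" using \<sigma> by auto
      then show "lay x \<le> (if x \<in> V - {s} then D - 1 else 0) + (if x \<in> B then 1 else 0)"
        using lay_le[of x] by (auto simp: B_def)
    qed
    also have "\<dots> = (D - 1) * card (set \<sigma> \<inter> (V - {s})) + card (set \<sigma> \<inter> B)"
      using sum.inter_restrict[of "set \<sigma>" "\<lambda>_. D - 1" "V - {s}"]
        sum.inter_restrict[of "set \<sigma>" "\<lambda>_. 1::nat" B]
      by (simp add: sum.distrib mult.commute)
    finally have "2 * alg_cost E (fresh_alg s) \<sigma>
        \<le> 2 * (D - 1) * card (set \<sigma> \<inter> (V - {s})) + 2 * card (set \<sigma> \<inter> B)"
      using fresh_alg_cost[OF \<sigma>] by simp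
    also have "\<dots> \<le> 2 * (D - 1) * sched_cost E cs + sched_cost E cs"
      using 1 2 by (intro add_mono mult_le_mono) auto
    also have "\<dots> = (2 * D - 1) * sched_cost E cs"
      using assms by (cases D) (auto simp: algebra_simps)
    finally show ?thesis using cs(2) by simp
  qed
  then have "real (2 * alg_cost E (fresh_alg s) \<sigma>) \<le> real ((2 * D - 1) * opt_cost V E s \<sigma>)"
    if "\<sigma> \<in> lists V" for \<sigma> using that of_nat_mono by blast
  then show ?thesis unfolding competitive_def
    by (intro exI[of _ 0]) (force simp: field_simps)
qed

end

section \<open>The adversary\<close>

text \<open>Only the covered nodes and a cost bound are recorded, not the schedule. Statements of
  this kind can be weakened freely and can coexist for different sets \<open>C\<close>, so the
  offline player may settle on one of them later.\<close>

definition offline ::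
  "'v set \<Rightarrow> ('v \<Rightarrow> 'v \<Rightarrow> bool) \<Rightarrow> 'v \<Rightarrow> 'v list \<Rightarrow> 'v set \<Rightarrow> nat \<Rightarrow> bool" where
  "offline V E s \<sigma> C n \<longleftrightarrow>
     (\<exists>cs. schedule V s \<sigma> cs \<and> sched_cost E cs \<le> n \<and> C \<subseteq> range (last cs))"

lemma offline_mono: "offline V E s \<sigma> C n \<Longrightarrow> C' \<subseteq> C \<Longrightarrow> n \<le> m \<Longrightarrow> offline V E s \<sigma> C' m"
  unfolding offline_def by (meson le_trans subset_trans)

lemma opt_cost_le: "offline V E s \<sigma> C n \<Longrightarrow> opt_cost V E s \<sigma> \<le> n"
proof -
  assume "offline V E s \<sigma> C n"
  then obtain cs where "schedule V s \<sigma> cs" "sched_cost E cs \<le> n" unfolding offline_def by blast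
  then show ?thesis unfolding opt_cost_def by (intro le_trans[OF wellorder_Inf_le1]) auto
qed

lemma schedule_last:
  assumes "schedule V s \<sigma> cs" shows "valid_conf V s (last cs)"
proof -
  have "cs \<noteq> []" using assms by (auto simp: schedule_def)
  then show ?thesis using assms by (simp add: schedule_def)
qed

lemma offline_append:
  assumes cs: "schedule V s \<sigma> cs" "sched_cost E cs \<le> n"
    and c: "valid_conf V s c" "r \<in> range c" "C \<subseteq> range c" "move_cost E (last cs) c \<le> k"
  shows "offline V E s (\<sigma> @ [r]) C (n + k)"
  unfolding offline_def
proof (intro exI conjI)
  have len: "length cs = Suc (length \<sigma>)" and "cs \<noteq> []" using cs(1) by (auto simp: schedule_def)
  show "schedule V s (\<sigma> @ [r]) (cs @ [c])"
    using cs(1) c(1,2) unfolding schedule_def by (auto simp: nth_append less_Suc_eq)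
  have "last cs = cs ! length \<sigma>" using len \<open>cs \<noteq> []\<close> by (simp add: last_conv_nth)
  then have "sched_cost E (cs @ [c]) = sched_cost E cs + move_cost E (last cs) c"
    unfolding sched_cost_def by (simp add: len nth_append)
  then show "sched_cost E (cs @ [c]) \<le> n + k" using cs(2) c(4) by simp
  show "C \<subseteq> range (last (cs @ [c]))" using c(3) by simp
qed

lemma offline_stay:
  assumes "offline V E s \<sigma> C n" "r \<in> C"
  shows "offline V E s (\<sigma> @ [r]) C n"
proof -
  obtain cs where cs: "schedule V s \<sigma> cs" "sched_cost E cs \<le> n" "C \<subseteq> range (last cs)"
    using assms unfolding offline_def by blast
  have "offline V E s (\<sigma> @ [r]) C (n + 0)"
    by (rule offline_append[OF cs(1,2) schedule_last[OF cs(1)] _ cs(3)])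
      (use cs(3) assms(2) in \<open>auto simp: move_cost_def\<close>)
  then show ?thesis by simp
qed

lemma offline_requests:
  "offline V E s \<sigma> C n \<Longrightarrow> \<tau> \<in> lists C \<Longrightarrow> offline V E s (\<sigma> @ \<tau>) C n"
proof (induction \<tau> rule: rev_induct)
  case (snoc r \<tau>)
  then show ?case using offline_stay[of V E s "\<sigma> @ \<tau>" C n r] by simp
qed simp

lemma offline_serve:
  assumes cs: "schedule V s \<sigma> cs" "sched_cost E cs \<le> n" and "r \<in> V" "gdist E (last cs i) r \<le> k"
    and C: "C \<subseteq> range ((last cs)(i := r))"
  shows "offline V E s (\<sigma> @ [r]) C (n + k)"
proof (rule offline_append[OF cs _ _ C])
  let ?c = "last cs"
  have *: "\<forall>j. ?c j \<in> V" "finite {j. ?c j \<noteq> s}"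
    using schedule_last[OF cs(1)] by (simp_all add: valid_conf_def)
  have "{j. (?c(i := r)) j \<noteq> s} \<subseteq> insert i {j. ?c j \<noteq> s}" by auto
  then have "finite {j. (?c(i := r)) j \<noteq> s}" by (rule finite_subset) (simp add: *(2))
  then show "valid_conf V s (?c(i := r))"
    using *(1) \<open>r \<in> V\<close> by (simp add: valid_conf_def)
  show "r \<in> range (?c(i := r))" by auto
  have "move_cost E ?c (?c(i := r)) = (\<Sum>j\<in>{i}. gdist E (?c j) ((?c(i := r)) j))"
    by (rule move_cost_eq) auto
  then show "move_cost E ?c (?c(i := r)) \<le> k" using assms(4) by simp
qed

context layered
begin

lemma offline_edge:
  assumes "offline V E s \<sigma> C n" "x \<in> C" "E x r"
  shows "offline V E s (\<sigma> @ [r]) (insert r (C - {x})) (n + 1)"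
proof -
  obtain cs where cs: "schedule V s \<sigma> cs" "sched_cost E cs \<le> n" "C \<subseteq> range (last cs)"
    using assms unfolding offline_def by blast
  then obtain i where i: "last cs i = x" using assms(2) by auto
  have "insert r (C - {x}) \<subseteq> range ((last cs)(i := r))"
  proof
    fix p assume p: "p \<in> insert r (C - {x})"
    show "p \<in> range ((last cs)(i := r))"
    proof (cases "p = r")
      case False
      then obtain j where "p = last cs j" using p cs(3) by auto
      then have "p = ((last cs)(i := r)) j" using p False i by auto
      then show ?thesis by blast
    qed auto
  qed
  then show ?thesis
    using offline_serve[OF cs(1,2) E_in(2)[OF assms(3)], of i 1] gdist_edge[OF assms(3)] i by simp
qed

lemma offline_source:
  assumes "offline V E s \<sigma> C n" "r \<in> V"
  shows "offline V E s (\<sigma> @ [r]) (insert r C) (n + lay r)"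
proof -
  obtain cs where cs: "schedule V s \<sigma> cs" "sched_cost E cs \<le> n" "C \<subseteq> range (last cs)"
    using assms unfolding offline_def by blast
  have fin: "finite {i. last cs i \<noteq> s}" using schedule_last[OF cs(1)] by (simp add: valid_conf_def)
  obtain i where i: "last cs i = s" using ex_new_if_finite[OF infinite_UNIV_nat fin] by auto
  \<comment> \<open>A second server at the source keeps \<open>s\<close> covered in case
    \<open>s \<in> C\<close>.\<close>
  obtain j where j: "last cs j = s" "j \<noteq> i"
    using ex_new_if_finite[OF infinite_UNIV_nat finite.insertI[OF fin, of i]] by auto
  have "insert r C \<subseteq> range ((last cs)(i := r))"
  proof
    fix p assume p: "p \<in> insert r C"
    show "p \<in> range ((last cs)(i := r))"
    proof (cases "p = r")
      case False
      then obtain k where k: "p = last cs k" using p cs(3) by auto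
      then have "p = ((last cs)(i := r)) (if k = i then j else k)" using i j by auto
      then show ?thesis by blast
    qed auto
  qed
  then show ?thesis
    using offline_serve[OF cs(1,2) assms(2), of i] gdist_source_le[OF assms(2)] i by simp
qed

lemma card_moved_le_move_cost:
  assumes "valid_conf V s c" "valid_conf V s c'"
  shows "card {i. c i \<noteq> c' i} \<le> move_cost E c c'"
  unfolding move_cost_def card_eq_sum
  by (rule sum_mono) (use assms gdist_ge_1 in \<open>auto simp: valid_conf_def\<close>)

lemma finite_moved:
  assumes "valid_conf V s c" "valid_conf V s c'"
  shows "finite {i. c i \<noteq> c' i}"
  using valid_conf_finite_neq[OF assms] finite_subset by blast

end

section \<open>The abstract gadget with its supply of fresh nodes\<close>

text \<open>
\<open>gt h\<close> is the set of nodes that may still be attached to once \<open>h\<close> has been requested. The set \<open>L\<close>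
collects everything that can ever be built on top of the fresh node \<open>w\<close>: since it avoids all
server positions \<open>P\<close>, a server reaches \<open>w\<close> only through \<open>M\<close> or the layers up to \<open>\<delta>\<close>.
\<close>

locale gadget = layered V E lay s "\<delta> + 2"
  for V :: "'v set" and E lay s and \<delta> :: nat +
  fixes gt :: "'v \<Rightarrow> 'v set"
  assumes \<delta>_le: "\<delta> \<le> 2"
    and gt_in: "h \<in> V \<Longrightarrow> gt h \<subseteq> V"
    and fresh: "\<lbrakk>h \<in> V; finite P; finite M; M \<subseteq> gt h; F \<subseteq> M;
        l = \<delta> + 1 \<and> (\<forall>f\<in>F. lay f = \<delta> + 2) \<or> l = \<delta> + 2 \<and> F \<noteq> {} \<and> (\<forall>f\<in>F. lay f = \<delta> + 1)\<rbrakk>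
      \<Longrightarrow> \<exists>w L. w \<in> V \<and> lay w = l \<and> insert w M \<subseteq> gt w \<and> (\<forall>f\<in>F. E f w) \<and> w \<in> L \<and> L \<inter> P = {} \<and>
            (\<forall>x\<in>L. \<delta> < lay x \<and> (\<forall>z. E x z \<longrightarrow> z \<in> L \<or> z \<in> M \<or> lay z \<le> \<delta>))"
begin

lemma fresh_A:
  assumes "h \<in> V" "finite P" "finite M" "M \<subseteq> gt h" "F \<subseteq> M" "\<And>f. f \<in> F \<Longrightarrow> lay f = \<delta> + 2"
  obtains w L where "w \<in> V" "lay w = \<delta> + 1" "insert w M \<subseteq> gt w" "\<And>f. f \<in> F \<Longrightarrow> E f w"
    "w \<in> L" "L \<inter> P = {}" "\<forall>x\<in>L. \<delta> < lay x \<and> (\<forall>z. E x z \<longrightarrow> z \<in> L \<or> z \<in> M \<or> lay z \<le> \<delta>)"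
proof -
  have "\<exists>w L. w \<in> V \<and> lay w = \<delta> + 1 \<and> insert w M \<subseteq> gt w \<and> (\<forall>f\<in>F. E f w) \<and> w \<in> L \<and> L \<inter> P = {} \<and>
      (\<forall>x\<in>L. \<delta> < lay x \<and> (\<forall>z. E x z \<longrightarrow> z \<in> L \<or> z \<in> M \<or> lay z \<le> \<delta>))"
    by (rule fresh[OF assms(1-5)]) (use assms(6) in simp)
  then show thesis by (elim exE conjE) (rule that; simp)
qed

lemma fresh_B:
  assumes "h \<in> V" "finite P" "finite M" "M \<subseteq> gt h" "F \<subseteq> M" "F \<noteq> {}" "\<And>f. f \<in> F \<Longrightarrow> lay f = \<delta> + 1"
  obtains w L where "w \<in> V" "lay w = \<delta> + 2" "insert w M \<subseteq> gt w" "\<And>f. f \<in> F \<Longrightarrow> E f w"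
    "w \<in> L" "L \<inter> P = {}" "\<forall>x\<in>L. \<delta> < lay x \<and> (\<forall>z. E x z \<longrightarrow> z \<in> L \<or> z \<in> M \<or> lay z \<le> \<delta>)"
proof -
  have "\<exists>w L. w \<in> V \<and> lay w = \<delta> + 2 \<and> insert w M \<subseteq> gt w \<and> (\<forall>f\<in>F. E f w) \<and> w \<in> L \<and> L \<inter> P = {} \<and>
      (\<forall>x\<in>L. \<delta> < lay x \<and> (\<forall>z. E x z \<longrightarrow> z \<in> L \<or> z \<in> M \<or> lay z \<le> \<delta>))"
    by (rule fresh[OF assms(1-5)]) (use assms(6,7) in simp)
  then show thesis by (elim exE conjE) (rule that; simp)
qed

section \<open>Weights of server positions\<close>

text \<open>
\<open>Q\<close> holds the B-nodes that the offline player may still occupy. The truncated subtraction in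
\<open>\<delta> - 1\<close> is intended: for \<open>\<delta> = 0\<close> an abandoned server in layer A has weight \<open>0\<close>, not \<open>-1\<close>.
\<close>

definition wt :: "'v set \<Rightarrow> 'v set \<Rightarrow> 'v \<Rightarrow> int" where
  "wt Act Q p =
     (if lay p \<le> \<delta> then int (lay p)
      else if lay p = \<delta> + 1 then (if p \<in> Act then int \<delta> + 1 else int (\<delta> - 1))
      else if p \<in> Q \<or> (\<exists>x\<in>Act. E x p) then int \<delta> else 0)"

text \<open>The weight lost by an A-node when it leaves \<open>Act\<close>: it is 1 for
  \<open>\<delta> = 0\<close> and 2 for \<open>\<delta> = 1\<close> and
  \<open>\<delta> = 2\<close>.\<close>

definition decay :: int where "decay = int \<delta> + 1 - int (\<delta> - 1)"

lemma decay_bounds: "0 \<le> decay" "decay \<le> 2"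
  unfolding decay_def by auto

lemma wt_nonneg: "0 \<le> wt Act Q p"
  and wt_s: "wt Act Q s = 0"
  unfolding wt_def by auto

lemma wt_mono: "Act' \<subseteq> Act \<Longrightarrow> Q' \<subseteq> Q \<Longrightarrow> wt Act' Q' p \<le> wt Act Q p"
  unfolding wt_def by auto

text \<open>The critical edge joins a B-node of weight 0 to an abandoned A-node of weight
  \<open>\<delta> - 1\<close>; there \<open>\<delta> \<le> 2\<close> enters. B-neighbours of an
  active A-node have weight \<open>\<delta>\<close>, one less than that node.\<close>

lemma wt_edge:
  assumes "E x y" shows "wt Act Q y \<le> wt Act Q x + 1"
proof -
  have "E y x" using assms E_sym by blast
  moreover have "lay x \<le> \<delta> + 2" "lay y \<le> \<delta> + 2" using E_in[OF assms] lay_le by auto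
  ultimately show ?thesis using E_lay[OF assms] assms \<delta>_le unfolding wt_def by auto
qed

lemma wt_lipschitz: "p \<in> V \<Longrightarrow> q \<in> V \<Longrightarrow> wt Act Q q - wt Act Q p \<le> int (gdist E p q)"
  by (rule gdist_lipschitz) (use wt_edge in auto)

text \<open>Only active A-nodes have weight \<open>\<delta> + 1\<close>. A server leaving one either
  goes to another node of the same layer, at distance at least 2, or loses weight at least 1 besides
  moving by at least 1.\<close>

lemma wt_leave:
  assumes "p \<in> V" "q \<in> V" "p \<noteq> q" "p \<in> Act" and Act: "\<And>x. x \<in> Act \<Longrightarrow> lay x = \<delta> + 1"
  shows "wt Act Q q + 2 \<le> int (gdist E p q) + wt Act Q p"
proof (cases "q \<in> Act")
  case True
  then show ?thesis using gdist_ge_2[OF assms(1-3)] assms(4) Act by (simp add: wt_def)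
next
  case False
  then have "wt Act Q q \<le> int \<delta>" by (auto simp: wt_def)
  then show ?thesis using gdist_ge_1[OF assms(1-3)] assms(4) Act by (simp add: wt_def)
qed

text \<open>When \<open>y\<close> is adjacent to an active node its weight is
  \<open>\<delta>\<close>, so the bound says that a server arriving there from outside
  \<open>L\<close> has excess 2 over the change of weight.\<close>

lemma wt_fresh_leaf:
  assumes L: "\<forall>x\<in>L. \<delta> < lay x \<and> (\<forall>z. E x z \<longrightarrow> z \<in> L \<or> z \<in> Act \<union> Q \<or> lay z \<le> \<delta>)"
    and Act: "\<And>x. x \<in> Act \<Longrightarrow> lay x = \<delta> + 1" and Q: "\<And>x. x \<in> Q \<Longrightarrow> lay x = \<delta> + 2"
    and y: "y \<in> L" "y \<in> V" "lay y = \<delta> + 2" and p: "p \<in> V" "p \<notin> L"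
  shows "int \<delta> + 2 \<le> int (gdist E p y) + wt Act Q p"
proof -
  \<comment> \<open>Inside \<open>L\<close>, A-nodes are treated as active and \<open>y\<close> is
    raised above all its neighbours. This stays 1-Lipschitz: exits from an A-node lead to weight
    \<open>\<delta>\<close> in \<open>Q\<close> or layer \<open>\<delta>\<close>, exits from a
    B-node to weight \<open>\<delta> + 1\<close> in \<open>Act\<close>.\<close>
  define \<psi> where "\<psi> x = (if x \<notin> L then wt Act Q x else if x = y then int \<delta> + 2
                          else if lay x = \<delta> + 1 then int \<delta> + 1 else int \<delta>)" for x
  have cross: "\<bar>\<psi> x - wt Act Q z\<bar> \<le> 1" if "x \<in> L" "z \<notin> L" "E x z" for x z
  proof -
    have "lay x \<le> \<delta> + 2" "\<delta> < lay x" using E_in[OF that(3)] lay_le L that by auto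
    moreover have "z \<in> Act \<or> z \<in> Q \<or> lay z \<le> \<delta>" using L that by blast
    ultimately show ?thesis
      using E_lay[OF that(3)] that Act[of z] Q[of z] y(3) unfolding \<psi>_def wt_def by auto
  qed
  have "\<psi> z \<le> \<psi> x + 1" if "E x z" for x z
  proof -
    have "lay x \<le> \<delta> + 2" "lay z \<le> \<delta> + 2" using E_in[OF that] lay_le by auto
    then have "\<psi> z \<le> \<psi> x + 1" if "x \<in> L" "z \<in> L"
      using that \<open>E x z\<close> E_lay[of x z] L y(3) unfolding \<psi>_def by (auto split: if_splits)
    moreover have "\<psi> z \<le> \<psi> x + 1" if "x \<in> L" "z \<notin> L"
      using cross[of x z] that \<open>E x z\<close> by (simp add: \<psi>_def)
    moreover have "\<psi> z \<le> \<psi> x + 1" if "x \<notin> L" "z \<in> L"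
      using cross[of z x] that E_sym[OF \<open>E x z\<close>] by (simp add: \<psi>_def)
    moreover have "\<psi> z \<le> \<psi> x + 1" if "x \<notin> L" "z \<notin> L"
      using wt_edge[OF \<open>E x z\<close>] that by (simp add: \<psi>_def)
    ultimately show ?thesis by blast
  qed
  then have "\<psi> y - \<psi> p \<le> int (gdist E p y)" by (intro gdist_lipschitz p y)
  then show ?thesis using y(1) p(2) by (simp add: \<psi>_def)
qed

end

section \<open>An online algorithm played against the gadget\<close>

locale gadget_alg = gadget +
  fixes alg :: "'a list \<Rightarrow> nat \<Rightarrow> 'a"
  assumes online: "online_alg V s alg"
begin

abbreviation cost :: "'a list \<Rightarrow> nat" where "cost \<equiv> alg_cost E alg"

text \<open>The part of the cost not stored as weight. With \<open>Act\<close> and \<open>Q\<close>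
  fixed it never decreases, because \<open>wt\<close> is 1-Lipschitz; it also rises when a change of
  \<open>Act\<close> or \<open>Q\<close> devalues positions of servers.\<close>

definition net :: "'a set \<Rightarrow> 'a set \<Rightarrow> 'a list \<Rightarrow> int" where
  "net Act Q \<sigma> = int (cost \<sigma>) - (\<Sum>i | alg \<sigma> i \<noteq> s. wt Act Q (alg \<sigma> i))"

lemma valid: "\<sigma> \<in> lists V \<Longrightarrow> valid_conf V s (alg \<sigma>)"
  and serves: "\<sigma> \<in> lists V \<Longrightarrow> r \<in> V \<Longrightarrow> r \<in> range (alg (\<sigma> @ [r]))"
  using online_algD[OF online] by blast+

lemma alg_in: "\<sigma> \<in> lists V \<Longrightarrow> alg \<sigma> i \<in> V"
  using valid by (simp add: valid_conf_def)

lemma net_step: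
  assumes \<sigma>: "\<sigma> \<in> lists V" "r \<in> V" and "finite J"
    and J: "\<And>i. i \<in> J \<Longrightarrow>
      wt Act Q (alg (\<sigma> @ [r]) i) + 2 \<le> int (gdist E (alg \<sigma> i) (alg (\<sigma> @ [r]) i)) + wt Act Q (alg \<sigma> i)"
  shows "net Act Q \<sigma> + 2 * int (card J) \<le> net Act Q (\<sigma> @ [r])"
proof -
  let ?c = "alg \<sigma>" and ?c' = "alg (\<sigma> @ [r])"
  have \<sigma>': "\<sigma> @ [r] \<in> lists V" using \<sigma> by simp
  define I where "I = {i. ?c i \<noteq> s} \<union> {i. ?c' i \<noteq> s}"
  note fin = valid_conf_finite_neq[OF valid[OF \<sigma>(1)] valid[OF \<sigma>'], folded I_def]
  \<comment> \<open>A server at the source before and after would give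
    \<open>2 \<le> 0\<close>.\<close>
  have JI: "J \<subseteq> I" using J by (fastforce simp: I_def)
  have "(\<Sum>i\<in>I. if i \<in> J then 2 else 0) \<le>
      (\<Sum>i\<in>I. int (gdist E (?c i) (?c' i)) + wt Act Q (?c i) - wt Act Q (?c' i))"
  proof (rule sum_mono)
    fix i
    show "(if i \<in> J then 2 else 0) \<le> int (gdist E (?c i) (?c' i)) + wt Act Q (?c i) - wt Act Q (?c' i)"
      using J[of i] wt_lipschitz[of "?c i" "?c' i" Act Q] alg_in[OF \<sigma>(1), of i] alg_in[OF \<sigma>', of i]
      by auto
  qed
  moreover have "(\<Sum>i\<in>I. if i \<in> J then 2 else 0) = 2 * int (card J)"
    using JI fin(1) by (simp add: sum.If_cases Int_absorb1)
  moreover have "(\<Sum>i\<in>I. wt Act Q (?c' i)) = (\<Sum>i | ?c' i \<noteq> s. wt Act Q (?c' i))"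
    by (rule sum.mono_neutral_right) (use fin wt_s in \<open>auto simp: I_def\<close>)
  moreover have "(\<Sum>i\<in>I. wt Act Q (?c i)) = (\<Sum>i | ?c i \<noteq> s. wt Act Q (?c i))"
    by (rule sum.mono_neutral_right) (use fin wt_s in \<open>auto simp: I_def\<close>)
  ultimately show ?thesis
    by (simp add: net_def alg_cost_snoc move_cost_eq[OF fin] sum.distrib sum_subtractf)
qed

lemma cost_mono: "cost \<sigma> \<le> cost (\<sigma> @ \<tau>)"
proof (induction \<tau> rule: rev_induct)
  case (snoc r \<tau>)
  then show ?case using alg_cost_snoc[of E alg "\<sigma> @ \<tau>" r] by simp
qed simp

lemma net_requests:
  assumes "\<sigma> \<in> lists V" "\<tau> \<in> lists V"
  shows "net Act Q \<sigma> \<le> net Act Q (\<sigma> @ \<tau>)"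
  using assms(2)
proof (induction \<tau> rule: rev_induct)
  case (snoc r \<tau>)
  then show ?case using net_step[of "\<sigma> @ \<tau>" r "{}" Act Q] assms(1) by simp
qed simp

text \<open>No server moves here: the gain is weight that is written off, and each covered node of
  \<open>S\<close> carries at least one server that loses \<open>k\<close>.\<close>

lemma net_change:
  assumes \<sigma>: "\<sigma> \<in> lists V" and le: "\<And>p. p \<in> range (alg \<sigma>) \<Longrightarrow> wt Act' Q' p \<le> wt Act Q p"
    and S: "S \<subseteq> range (alg \<sigma>)" "s \<notin> S" "\<And>p. p \<in> S \<Longrightarrow> wt Act' Q' p + k \<le> wt Act Q p" and "0 \<le> k"
  shows "net Act Q \<sigma> + k * int (card S) \<le> net Act' Q' \<sigma>"
proof -
  define I where "I = {i. alg \<sigma> i \<noteq> s}"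
  have fin: "finite I" using valid[OF \<sigma>] by (simp add: I_def valid_conf_def)
  let ?J = "{i \<in> I. alg \<sigma> i \<in> S}"
  have "S \<subseteq> alg \<sigma> ` ?J" using S(1,2) by (fastforce simp: I_def image_iff)
  then have "card S \<le> card ?J" using fin by (intro surj_card_le) auto
  then have "k * int (card S) \<le> (\<Sum>i\<in>?J. k)" using \<open>0 \<le> k\<close> by (simp add: mult.commute mult_left_mono)
  also have "\<dots> = (\<Sum>i\<in>I. if alg \<sigma> i \<in> S then k else 0)"
    by (rule sum.inter_filter) (rule fin)
  also have "\<dots> \<le> (\<Sum>i\<in>I. wt Act Q (alg \<sigma> i) - wt Act' Q' (alg \<sigma> i))"
    by (rule sum_mono) (use le S(3) in force)
  finally show ?thesis by (simp add: net_def sum_subtractf I_def)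
qed

lemma net_shrink:
  "\<sigma> \<in> lists V \<Longrightarrow> Act' \<subseteq> Act \<Longrightarrow> Q' \<subseteq> Q \<Longrightarrow> net Act Q \<sigma> \<le> net Act' Q' \<sigma>"
  using net_change[of \<sigma> Act' Q' Act Q "{}" 0] wt_mono[of Act' Act Q' Q] by simp

text \<open>Activation can raise the weight only of \<open>a\<close> and its B-neighbours. No server
  is in \<open>L\<close>, and the B-neighbours of \<open>a\<close> outside \<open>L\<close> are in
  \<open>Q\<close>, where the weight is \<open>\<delta>\<close> already.\<close>

lemma net_activate:
  assumes \<sigma>: "\<sigma> \<in> lists V" and L: "L \<inter> range (alg \<sigma>) = {}" "a \<in> L" "lay a = \<delta> + 1"
    "\<forall>x\<in>L. \<forall>z. E x z \<longrightarrow> z \<in> L \<or> z \<in> Act \<union> Q \<or> lay z \<le> \<delta>"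
    and Act: "\<And>x. x \<in> Act \<Longrightarrow> lay x = \<delta> + 1"
  shows "net Act Q \<sigma> \<le> net (insert a Act) Q \<sigma>"
proof -
  have "wt (insert a Act) Q p \<le> wt Act Q p" if p: "p \<in> range (alg \<sigma>)" for p
  proof -
    have "p \<notin> L" using L(1) p by blast
    then have "p \<noteq> a" "E a p \<Longrightarrow> p \<in> Act \<union> Q \<or> lay p \<le> \<delta>" using L by blast+
    then show ?thesis using Act[of p] unfolding wt_def by auto
  qed
  then show ?thesis using net_change[of \<sigma> "insert a Act" Q Act Q "{}" 0] \<sigma> by simp
qed

text \<open>Serving \<open>y\<close> has excess 2. If \<open>u\<close> or \<open>a\<close> is still
  covered afterwards, that node becomes \<open>b\<close>, to be vacated by the offline player, and
  its weight falls by \<open>decay\<close>. If neither is covered, an excess of 4 has already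
  accumulated, and \<open>decay \<le> 2\<close>. The last request makes the algorithm cover the new
  active node \<open>u'\<close>.\<close>

lemma step:
  assumes \<sigma>: "\<sigma> \<in> lists V" and h: "h \<in> V"
    and Q: "finite Q" "insert u Q \<subseteq> gt h" "\<And>q. q \<in> Q \<Longrightarrow> lay q = \<delta> + 2"
    and u: "lay u = \<delta> + 1" "u \<in> range (alg \<sigma>)"
  obtains a y b u' h' where
    "a \<in> V" "lay a = \<delta> + 1" "\<And>q. q \<in> Q \<Longrightarrow> E q a" "y \<in> V" "lay y = \<delta> + 2" "y \<notin> Q"
    "{b, u'} = {u, a}" "b \<noteq> u'" "E b y" "h' \<in> V" "insert u' (insert y Q) \<subseteq> gt h'"
    "u' \<in> range (alg (\<sigma> @ [a, y, u']))"
    "net {u} Q \<sigma> + 2 + decay \<le> net {u'} (insert y Q) (\<sigma> @ [a, y, u'])"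
proof -
  have uV: "u \<in> V" and QV: "Q \<subseteq> V" using Q(2) gt_in[OF h] by auto
  have fr: "finite (range (alg \<sigma>))" if "\<sigma> \<in> lists V" for \<sigma>
    using valid[OF that] by (rule valid_conf_finite_range)
  obtain a L where a: "a \<in> V" "lay a = \<delta> + 1" "insert a (insert u Q) \<subseteq> gt a"
      "\<And>q. q \<in> Q \<Longrightarrow> E q a" "a \<in> L" "L \<inter> (range (alg \<sigma>) \<union> {u}) = {}"
      "\<forall>x\<in>L. \<delta> < lay x \<and> (\<forall>z. E x z \<longrightarrow> z \<in> L \<or> z \<in> insert u Q \<or> lay z \<le> \<delta>)"
    by (rule fresh_A[OF h _ _ Q(2) subset_insertI Q(3), of "range (alg \<sigma>) \<union> {u}"])
      (use fr[OF \<sigma>] Q(1) in auto)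
  have "a \<noteq> u" using a(5,6) by blast
  have 1: "net {u} Q \<sigma> \<le> net {u, a} Q \<sigma>"
    using net_activate[of \<sigma> L a "{u}" Q] \<sigma> a u(1) by (auto simp: insert_commute)
  define \<sigma>1 where "\<sigma>1 = \<sigma> @ [a]"
  have \<sigma>1: "\<sigma>1 \<in> lists V" using \<sigma> a(1) by (simp add: \<sigma>1_def)
  have Act: "\<And>x. x \<in> {u, a} \<Longrightarrow> lay x = \<delta> + 1" using u a by auto
  have 2: "net {u, a} Q \<sigma> \<le> net {u, a} Q \<sigma>1"
    unfolding \<sigma>1_def using net_requests[OF \<sigma>, of "[a]"] a(1) by simp
  have left_u: "net {u, a} Q \<sigma> + 2 \<le> net {u, a} Q \<sigma>1" if "u \<notin> range (alg \<sigma>1)"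
  proof -
    obtain i where i: "u = alg \<sigma> i" using u(2) by auto
    have "alg \<sigma> i \<noteq> alg \<sigma>1 i" using i that by (metis rangeI)
    then show ?thesis
      using net_step[OF \<sigma> a(1), of "{i}" "{u, a}" Q]
        wt_leave[OF alg_in[OF \<sigma>] alg_in[OF \<sigma>1], of i i "{u, a}" Q] Act i
      by (simp add: \<sigma>1_def)
  qed
  obtain y K where y: "y \<in> V" "lay y = \<delta> + 2" "insert y (insert a (insert u Q)) \<subseteq> gt y"
      "\<And>f. f \<in> {u, a} \<Longrightarrow> E f y" "y \<in> K" "K \<inter> (range (alg \<sigma>1) \<union> Q) = {}"
      "\<forall>x\<in>K. \<delta> < lay x \<and> (\<forall>z. E x z \<longrightarrow> z \<in> K \<or> z \<in> insert a (insert u Q) \<or> lay z \<le> \<delta>)"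
    by (rule fresh_B[OF a(1) _ _ a(3), of "range (alg \<sigma>1) \<union> Q" "{u, a}"])
      (use fr[OF \<sigma>1] Q(1) Act in auto)
  define \<sigma>2 where "\<sigma>2 = \<sigma>1 @ [y]"
  have \<sigma>2: "\<sigma>2 \<in> lists V" using \<sigma>1 y(1) by (simp add: \<sigma>2_def)
  have "y \<notin> Q" using y(5,6) by blast
  have wty: "wt {u, a} Q y = int \<delta>" using y by (auto simp: wt_def)
  have 3: "net {u, a} Q \<sigma>1 + 2 \<le> net {u, a} Q \<sigma>2"
  proof -
    obtain i where i: "alg \<sigma>2 i = y" using serves[OF \<sigma>1 y(1)] unfolding \<sigma>2_def by (metis rangeE)
    have "alg \<sigma>1 i \<notin> K" using y(6) by blast
    then have "int \<delta> + 2 \<le> int (gdist E (alg \<sigma>1 i) y) + wt {u, a} Q (alg \<sigma>1 i)"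
      using wt_fresh_leaf[of K "{u, a}" Q y "alg \<sigma>1 i"] y Act Q(3) alg_in[OF \<sigma>1] by auto
    then show ?thesis
      using net_step[OF \<sigma>1 y(1), of "{i}" "{u, a}" Q] i wty by (simp add: \<sigma>2_def)
  qed
  have left_both: "net {u, a} Q \<sigma>1 + 4 \<le> net {u, a} Q \<sigma>2"
    if "{u, a} \<subseteq> range (alg \<sigma>1)" and out: "{u, a} \<inter> range (alg \<sigma>2) = {}"
  proof -
    obtain i j where ij: "u = alg \<sigma>1 i" "a = alg \<sigma>1 j" using \<open>{u, a} \<subseteq> _\<close> by auto
    have "i \<noteq> j" using ij \<open>a \<noteq> u\<close> by auto
    moreover have "wt {u, a} Q (alg \<sigma>2 k) + 2 \<le> int (gdist E (alg \<sigma>1 k) (alg \<sigma>2 k)) + wt {u, a} Q (alg \<sigma>1 k)"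
      if "k \<in> {i, j}" for k
    proof -
      have "alg \<sigma>1 k \<in> {u, a}" using that ij by auto
      moreover have "alg \<sigma>2 k \<notin> {u, a}" using out by blast
      ultimately show ?thesis using wt_leave[OF alg_in[OF \<sigma>1] alg_in[OF \<sigma>2] _ _ Act] by metis
    qed
    ultimately show ?thesis
      using net_step[OF \<sigma>1 y(1), of "{i, j}" "{u, a}" Q] by (simp add: \<sigma>2_def)
  qed
  \<comment> \<open>Adding \<open>y\<close> to \<open>Q\<close> raises no weight, since
    \<open>y\<close> had weight \<open>\<delta>\<close> as a neighbour of \<open>u\<close> and
    \<open>a\<close>.\<close>
  have wt_after: "wt {u'} (insert y Q) p \<le> wt {u, a} Q p" if "u' \<in> {u, a}" for u' p
  proof (cases "p = y")
    case True
    then show ?thesis unfolding True wty using y(2) by (simp add: wt_def)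
  next
    case False
    then have "wt {u'} (insert y Q) p = wt {u'} Q p" by (simp add: wt_def)
    then show ?thesis using wt_mono[of "{u'}" "{u, a}" Q Q p] that by simp
  qed
  have 4: "net {u, a} Q \<sigma>2 + decay \<le> net {u'} (insert y Q) \<sigma>2"
    if "b \<in> range (alg \<sigma>2)" "{b, u'} = {u, a}" "b \<noteq> u'" for b u'
  proof -
    have b: "lay b = \<delta> + 1" "b \<in> {u, a}" "u' \<in> {u, a}" using that(2) Act by blast+
    then have "s \<noteq> b" using lay_s by (metis Suc_eq_plus1 nat.distinct(1))
    moreover have "wt {u'} (insert y Q) b + decay \<le> wt {u, a} Q b"
      using b that(3) unfolding wt_def decay_def by auto
    ultimately show ?thesis
      using net_change[OF \<sigma>2, of "{u'}" "insert y Q" "{u, a}" Q "{b}" decay]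
        wt_after[OF b(3)] that(1) decay_bounds by simp
  qed
  \<comment> \<open>With both nodes bare, either \<open>u\<close> was left when \<open>a\<close> was
    requested, and this excess adds to that of \<open>y\<close>, or servers leave \<open>u\<close>
    and \<open>a\<close> together when \<open>y\<close> is requested. Both ways give 4.\<close>
  have "\<exists>b u'. {b, u'} = {u, a} \<and> b \<noteq> u' \<and> net {u} Q \<sigma> + 2 + decay \<le> net {u'} (insert y Q) \<sigma>2"
  proof (cases "{u, a} \<inter> range (alg \<sigma>2) = {}")
    case True
    have "a \<in> range (alg \<sigma>1)" unfolding \<sigma>1_def by (rule serves[OF \<sigma> a(1)])
    then have "net {u, a} Q \<sigma> + 4 \<le> net {u, a} Q \<sigma>2"
      using True 2 left_u 3 left_both by (cases "u \<in> range (alg \<sigma>1)") auto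
    moreover have "net {u, a} Q \<sigma>2 \<le> net {a} (insert y Q) \<sigma>2"
      using net_change[OF \<sigma>2, of "{a}" "insert y Q" "{u, a}" Q "{}" 0] wt_after[of a] by simp
    ultimately have "net {u} Q \<sigma> + 2 + decay \<le> net {a} (insert y Q) \<sigma>2"
      using 1 decay_bounds by simp
    then show ?thesis using \<open>a \<noteq> u\<close> by blast
  next
    case False
    then obtain b u' where b: "b \<in> range (alg \<sigma>2)" "{b, u'} = {u, a}" "b \<noteq> u'"
      using \<open>a \<noteq> u\<close> by blast
    then have "net {u} Q \<sigma> + 2 + decay \<le> net {u'} (insert y Q) \<sigma>2"
      using 1 2 3 4[OF b] by simp
    then show ?thesis using b by blast
  qed
  then obtain b u' where b: "{b, u'} = {u, a}" "b \<noteq> u'"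
    and gain: "net {u} Q \<sigma> + 2 + decay \<le> net {u'} (insert y Q) \<sigma>2" by blast
  have u': "u' \<in> {u, a}" "b \<in> {u, a}" using b(1) by blast+
  then have "u' \<in> V" using a(1) uV by auto
  have eq: "\<sigma>2 @ [u'] = \<sigma> @ [a, y, u']" by (simp add: \<sigma>1_def \<sigma>2_def)
  show thesis
  proof (rule that[OF a(1,2) _ y(1,2) \<open>y \<notin> Q\<close> b _ y(1)])
    show "E b y" using u' y(4) by blast
    show "insert u' (insert y Q) \<subseteq> gt y" using u' y(3) by blast
    show "u' \<in> range (alg (\<sigma> @ [a, y, u']))" using serves[OF \<sigma>2 \<open>u' \<in> V\<close>] eq by simp
    show "net {u} Q \<sigma> + 2 + decay \<le> net {u'} (insert y Q) (\<sigma> @ [a, y, u'])"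
      using net_requests[OF \<sigma>2, of "[u']" "{u'}" "insert y Q"] gain \<open>u' \<in> V\<close> eq by simp
  qed (use a(4) in blast)
qed

text \<open>The offline player decides only at the end which \<open>K\<close> nodes \<open>X\<close> of \<open>T\<close> its servers left.\<close>

lemma steps:
  assumes \<sigma>: "\<sigma> \<in> lists V" and h: "h \<in> V"
    and T: "finite T" "insert u T \<subseteq> gt h" "\<forall>q\<in>T. lay q = \<delta> + 2"
    and u: "lay u = \<delta> + 1" "u \<in> range (alg \<sigma>)" and off: "offline V E s \<sigma> (insert u T) n"
  shows "\<exists>\<tau> h' Y u'. \<tau> \<in> lists V \<and> h' \<in> V \<and> finite Y \<and> card Y = K \<and> Y \<inter> T = {} \<and>
     (\<forall>y\<in>Y. lay y = \<delta> + 2) \<and> insert u' (T \<union> Y) \<subseteq> gt h' \<and> lay u' = \<delta> + 1 \<and>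
     u' \<in> range (alg (\<sigma> @ \<tau>)) \<and>
     (\<forall>X\<subseteq>T. card X = K \<longrightarrow> offline V E s (\<sigma> @ \<tau>) (insert u' (T - X \<union> Y)) (n + 2 * K)) \<and>
     net {u} T \<sigma> + int K * (2 + decay) \<le> net {u'} (T \<union> Y) (\<sigma> @ \<tau>)"
proof (induction K)
  case 0
  have empty: "offline V E s \<sigma> (insert u (T - X)) n" if "X \<subseteq> T" "card X = 0" for X
  proof -
    have "X = {}" using that T(1) by (metis card_0_eq finite_subset)
    then show ?thesis using off by simp
  qed
  show ?case
    by (rule exI[of _ "[]"], rule exI[of _ h], rule exI[of _ "{}"], rule exI[of _ u])
      (use assms empty in auto)
next
  case (Suc K)
  from Suc.IH obtain \<tau> h' Y u' where IH: "\<tau> \<in> lists V" "h' \<in> V" "finite Y" "card Y = K" "Y \<inter> T = {}"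
     "\<forall>y\<in>Y. lay y = \<delta> + 2" "insert u' (T \<union> Y) \<subseteq> gt h'" "lay u' = \<delta> + 1"
     "u' \<in> range (alg (\<sigma> @ \<tau>))"
     "\<forall>X\<subseteq>T. card X = K \<longrightarrow> offline V E s (\<sigma> @ \<tau>) (insert u' (T - X \<union> Y)) (n + 2 * K)"
     "net {u} T \<sigma> + int K * (2 + decay) \<le> net {u'} (T \<union> Y) (\<sigma> @ \<tau>)"
    by (elim exE conjE) (rule that)
  have \<sigma>\<tau>: "\<sigma> @ \<tau> \<in> lists V" using \<sigma> IH(1) by simp
  obtain a y b v g where st:
    "a \<in> V" "lay a = \<delta> + 1" "\<And>q. q \<in> T \<union> Y \<Longrightarrow> E q a" "y \<in> V" "lay y = \<delta> + 2" "y \<notin> T \<union> Y"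
    "{b, v} = {u', a}" "b \<noteq> v" "E b y" "g \<in> V" "insert v (insert y (T \<union> Y)) \<subseteq> gt g"
    "v \<in> range (alg ((\<sigma> @ \<tau>) @ [a, y, v]))"
    "net {u'} (T \<union> Y) (\<sigma> @ \<tau>) + 2 + decay \<le> net {v} (insert y (T \<union> Y)) ((\<sigma> @ \<tau>) @ [a, y, v])"
    by (rule step[OF \<sigma>\<tau> IH(2) _ IH(7) _ IH(8,9)]) (use T IH in auto)
  have v: "v \<in> {u', a}" "b \<in> {u', a}" using st(7) by blast+
  then have "v \<in> V" using st(1,11) gt_in[OF st(10)] by blast
  have "offline V E s (\<sigma> @ (\<tau> @ [a, y, v])) (insert v (T - X \<union> insert y Y)) (n + 2 * Suc K)"
    if X: "X \<subseteq> T" "card X = Suc K" for X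
  proof -
    \<comment> \<open>The server on \<open>x\<close> moves to \<open>a\<close>, then the one on
      \<open>b\<close> moves to \<open>y\<close>, at cost 1 each. Since \<open>a\<close> is adjacent
      to all of \<open>T\<close>, the same requests suit every \<open>X\<close>, and the hypothesis
      for \<open>X - {x}\<close> applies.\<close>
    obtain x where x: "x \<in> X" using X(2) by fastforce
    have "card (X - {x}) = K" using X x by simp
    then have 1: "offline V E s (\<sigma> @ \<tau>) (insert u' (T - (X - {x}) \<union> Y)) (n + 2 * K)"
      using IH(10) X by blast
    have "x \<in> T" using X x by blast
    then have "x \<notin> Y" "x \<noteq> u'" "E x a" "x \<noteq> a" using IH(5,8) T(3) st by auto
    have 2: "offline V E s ((\<sigma> @ \<tau>) @ [a]) (insert a (insert u' (T - X \<union> Y))) (n + 2 * K + 1)"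
      by (rule offline_mono[OF offline_edge[OF 1 _ \<open>E x a\<close>]])
        (use \<open>x \<in> T\<close> x \<open>x \<notin> Y\<close> \<open>x \<noteq> u'\<close> in auto)
    have lb: "b \<notin> T \<union> Y" using v(2) IH(6,8) T(3) st(2) by auto
    have 3: "offline V E s (((\<sigma> @ \<tau>) @ [a]) @ [y]) (insert v (T - X \<union> insert y Y)) (n + 2 * K + 1 + 1)"
      by (rule offline_mono[OF offline_edge[OF 2 _ st(9)]]) (use v st(8) lb in auto)
    show ?thesis using offline_stay[OF 3, of v] by simp
  qed
  moreover have "\<tau> @ [a, y, v] \<in> lists V" using IH(1) st(1,4) \<open>v \<in> V\<close> by simp
  moreover have "card (insert y Y) = Suc K" using IH(3,4) st(6) by simp
  moreover have "lay v = \<delta> + 1" using v(1) IH(8) st(2) by auto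
  moreover have "net {u} T \<sigma> + int (Suc K) * (2 + decay) \<le> net {v} (T \<union> insert y Y) (\<sigma> @ (\<tau> @ [a, y, v]))"
    using IH(11) st(13) by (simp add: algebra_simps)
  moreover have "insert v (T \<union> insert y Y) \<subseteq> gt g" using st(11) by auto
  moreover have "v \<in> range (alg (\<sigma> @ (\<tau> @ [a, y, v])))" using st(12) by simp
  moreover have "insert y Y \<inter> T = {}" using IH(5) st(6) by blast
  moreover have "\<forall>x\<in>insert y Y. lay x = \<delta> + 2" "finite (insert y Y)" using IH(3,6) st(5) by auto
  ultimately show ?case using st(10) by blast
qed

text \<open>A node of \<open>T\<close> becomes uncovered only if a server moves away from it, which
  costs at least 1.\<close>

lemma uncovered_le_cost:
  assumes "\<sigma> \<in> lists V" "\<tau> \<in> lists V" "finite T" "T \<subseteq> range (alg \<sigma>)"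
  shows "cost \<sigma> + card (T - range (alg (\<sigma> @ \<tau>))) \<le> cost (\<sigma> @ \<tau>)"
  using assms(2)
proof (induction \<tau> rule: rev_induct)
  case Nil
  then have "T - range (alg \<sigma>) = {}" using assms(4) by blast
  then show ?case by (metis append_Nil2 card.empty add_0_right order_refl)
next
  case (snoc r \<tau>)
  let ?c = "alg (\<sigma> @ \<tau>)" and ?c' = "alg ((\<sigma> @ \<tau>) @ [r])"
  have v: "valid_conf V s ?c" "valid_conf V s ?c'" 
    using valid[of "\<sigma> @ \<tau>"] valid[of "(\<sigma> @ \<tau>) @ [r]"] assms(1) snoc.prems by simp_all
  have "T - range ?c' \<subseteq> (T - range ?c) \<union> ?c ` {i. ?c i \<noteq> ?c' i}"
    by (auto simp: image_iff)
  then have "card (T - range ?c') \<le> card ((T - range ?c) \<union> ?c ` {i. ?c i \<noteq> ?c' i})"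
    using assms(3) finite_moved[OF v] by (intro card_mono) auto
  also have "\<dots> \<le> card (T - range ?c) + card {i. ?c i \<noteq> ?c' i}"
    using card_Un_le card_image_le[OF finite_moved[OF v], of ?c] by (meson add_left_mono le_trans)
  finally show ?case
    using snoc card_moved_le_move_cost[OF v] alg_cost_snoc[of E alg "\<sigma> @ \<tau>" r] by simp
qed

text \<open>Requesting uncovered nodes of \<open>C\<close> over and over costs the offline player
  nothing and the algorithm at least 1 each time. A competitive algorithm must therefore cover all
  of \<open>C\<close> at some point.\<close>

lemma force:
  assumes comp: "competitive V E s alg \<rho>" "0 \<le> \<rho>"
    and \<sigma>: "\<sigma> \<in> lists V" "C \<subseteq> V" "offline V E s \<sigma> C n"
  obtains \<tau> where "\<tau> \<in> lists C" "C \<subseteq> range (alg (\<sigma> @ \<tau>))"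
proof (rule ccontr)
  assume "\<not> thesis"
  with that have un: "\<exists>r\<in>C. r \<notin> range (alg (\<sigma> @ \<tau>))" if "\<tau> \<in> lists C" for \<tau>
    using that by (meson subsetI)
  have unb: "\<exists>\<tau>\<in>lists C. k \<le> cost (\<sigma> @ \<tau>)" for k
  proof (induction k)
    case 0
    then show ?case by (intro bexI[of _ "[]"]) auto
  next
    case (Suc k)
    then obtain \<tau> where \<tau>: "\<tau> \<in> lists C" "k \<le> cost (\<sigma> @ \<tau>)" by blast
    then obtain r where r: "r \<in> C" "r \<notin> range (alg (\<sigma> @ \<tau>))" using un by blast
    have l: "\<sigma> @ \<tau> \<in> lists V" "r \<in> V" using \<sigma> \<tau>(1) r(1) by auto
    let ?c = "alg (\<sigma> @ \<tau>)" and ?c' = "alg ((\<sigma> @ \<tau>) @ [r])"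
    have v: "valid_conf V s ?c" "valid_conf V s ?c'" 
      using valid[of "\<sigma> @ \<tau>"] valid[of "(\<sigma> @ \<tau>) @ [r]"] l by simp_all
    obtain i where "?c' i = r" using serves[OF l] by (metis rangeE)
    then have "i \<in> {i. ?c i \<noteq> ?c' i}" using r(2) by auto
    then have "card {i. ?c i \<noteq> ?c' i} \<noteq> 0" using finite_moved[OF v] by auto
    then have "1 \<le> move_cost E ?c ?c'" using card_moved_le_move_cost[OF v] by simp
    then have "Suc k \<le> cost (\<sigma> @ (\<tau> @ [r]))"
      using \<tau>(2) alg_cost_snoc[of E alg "\<sigma> @ \<tau>" r] by simp
    moreover have "\<tau> @ [r] \<in> lists C" using \<tau>(1) r(1) by simp
    ultimately show ?case by blast
  qed
  obtain c where c: "\<And>\<sigma>. \<sigma> \<in> lists V \<Longrightarrow> real (cost \<sigma>) \<le> \<rho> * real (opt_cost V E s \<sigma>) + c"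
    using comp(1) unfolding competitive_def by blast
  obtain k :: nat where k: "\<rho> * real n + c < real k" using reals_Archimedean2 by blast
  obtain \<tau> where \<tau>: "\<tau> \<in> lists C" "k \<le> cost (\<sigma> @ \<tau>)" using unb[of k] by blast
  have "\<sigma> @ \<tau> \<in> lists V" using \<sigma> \<tau>(1) by auto
  then have "real (cost (\<sigma> @ \<tau>)) \<le> \<rho> * real (opt_cost V E s (\<sigma> @ \<tau>)) + c" by (rule c)
  also have "\<dots> \<le> \<rho> * real n + c"
    using opt_cost_le[OF offline_requests[OF \<sigma>(3) \<tau>(1)]] comp(2) by (simp add: mult_left_mono)
  finally show False using k \<tau>(2) by simp
qed

text \<open>One A-node \<open>u\<close> serves as attachment point for all B-nodes; each of these
  receives a server straight from the source, and the server on \<open>u\<close> is forgotten at the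
  end.\<close>

lemma start:
  obtains \<sigma> h T where "\<sigma> \<in> lists V" "h \<in> V" "finite T" "T \<subseteq> gt h" "card T = N"
    "\<forall>q\<in>T. lay q = \<delta> + 2" "offline V E s \<sigma> T ((\<delta> + 1) + N * (\<delta> + 2))"
proof -
  obtain u where u: "u \<in> V" "lay u = \<delta> + 1" "{u} \<subseteq> gt u"
    by (rule fresh_A[of s "{}" "{}" "{}"]) auto
  have ex: "\<exists>\<sigma> h T. \<sigma> \<in> lists V \<and> h \<in> V \<and> finite T \<and> insert u T \<subseteq> gt h \<and> card T = N \<and>
      (\<forall>q\<in>T. lay q = \<delta> + 2) \<and> offline V E s \<sigma> (insert u T) ((\<delta> + 1) + N * (\<delta> + 2))" for N
  proof (induction N)
    case 0
    have "schedule V s [] [\<lambda>_. s]" by (simp add: schedule_def valid_conf_def)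
    then have "offline V E s [] {} 0"
      unfolding offline_def by (intro exI[of _ "[\<lambda>_. s]"]) (simp add: sched_cost_def)
    from offline_source[OF this u(1)] have off: "offline V E s [u] {u} (\<delta> + 1)" using u(2) by simp
    show ?case
      by (rule exI[of _ "[u]"], rule exI[of _ u], rule exI[of _ "{}"]) (use u off in auto)
  next
    case (Suc N)
    from Suc.IH obtain \<sigma> h T where IH: "\<sigma> \<in> lists V" "h \<in> V" "finite T" "insert u T \<subseteq> gt h"
      "card T = N" "\<forall>q\<in>T. lay q = \<delta> + 2" "offline V E s \<sigma> (insert u T) ((\<delta> + 1) + N * (\<delta> + 2))"
      by (elim exE conjE) (rule that)
    obtain y L where y: "y \<in> V" "lay y = \<delta> + 2" "insert y (insert u T) \<subseteq> gt y" "y \<in> L" "L \<inter> T = {}"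
      by (rule fresh_B[OF IH(2,3) _ IH(4), of "{u}"]) (use IH(3) u(2) in auto)
    then have "y \<notin> T" by blast
    show ?case
    proof (intro exI conjI)
      show "offline V E s (\<sigma> @ [y]) (insert u (insert y T)) ((\<delta> + 1) + Suc N * (\<delta> + 2))"
        using offline_source[OF IH(7) y(1)] y(2)
        by (simp add: insert_commute algebra_simps)
      show "\<sigma> @ [y] \<in> lists V" using IH(1) y(1) by simp
      show "y \<in> V" by (rule y)
      show "insert u (insert y T) \<subseteq> gt y" using y(3) by blast
      show "card (insert y T) = Suc N" using IH(3,5) \<open>y \<notin> T\<close> by simp
    qed (use IH y in auto)
  qed
  from ex[of N] obtain \<sigma> h T where "\<sigma> \<in> lists V" "h \<in> V" "finite T" "insert u T \<subseteq> gt h"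
      "card T = N" "\<forall>q\<in>T. lay q = \<delta> + 2" "offline V E s \<sigma> (insert u T) ((\<delta> + 1) + N * (\<delta> + 2))"
    by (elim exE conjE) (rule that)
  then show thesis using that[of \<sigma> h T] offline_mono[of V E s \<sigma> "insert u T"] by blast
qed

text \<open>The share \<open>1 - \<theta>\<close> of the plain cost pays for epochs in which the algorithm deserts \<open>T\<close>.\<close>

definition pot :: "real \<Rightarrow> 'a set \<Rightarrow> 'a list \<Rightarrow> real" where
  "pot \<theta> Q \<sigma> = \<theta> * real_of_int (net {} Q \<sigma>) + (1 - \<theta>) * real (cost \<sigma>)"

text \<open>Per step of an epoch, \<open>2 + decay\<close> comes from \<open>step\<close>, and
  \<open>\<delta>\<close> from the weight of a node of \<open>T\<close> that is vacated at the
  end.\<close>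

definition gain :: int where "gain = 2 + decay + int \<delta>"

lemma pot_le_cost: "0 \<le> \<theta> \<Longrightarrow> pot \<theta> Q \<sigma> \<le> real (cost \<sigma>)"
proof -
  assume \<theta>: "0 \<le> \<theta>"
  have "0 \<le> (\<Sum>i | alg \<sigma> i \<noteq> s. wt {} Q (alg \<sigma> i))" by (intro sum_nonneg wt_nonneg)
  then have "real_of_int (net {} Q \<sigma>) \<le> real (cost \<sigma>)" unfolding net_def by linarith
  then have "\<theta> * real_of_int (net {} Q \<sigma>) \<le> \<theta> * real (cost \<sigma>)" using \<theta> by (rule mult_left_mono)
  then show ?thesis unfolding pot_def by (simp add: algebra_simps)
qed

text \<open>An epoch opens a fresh A-node \<open>u\<close>, forces the algorithm onto
  \<open>insert u T\<close>, plays \<open>K\<close> steps and replaces \<open>K\<close> nodes of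
  \<open>T\<close> by the new B-nodes. The offline player pays \<open>\<delta> + 1\<close> for
  \<open>u\<close> and 2 per step.\<close>

lemma epoch:
  fixes \<theta> \<rho> :: real
  assumes comp: "competitive V E s alg \<rho>" "0 \<le> \<rho>"
    and \<theta>: "0 \<le> \<theta>" "\<theta> \<le> 1" and K: "K \<le> N" "\<theta> * (gain * K) \<le> (1 - \<theta>) * real (N - K)"
    and \<sigma>: "\<sigma> \<in> lists V" and h: "h \<in> V"
    and T: "finite T" "T \<subseteq> gt h" "card T = N" "\<And>q. q \<in> T \<Longrightarrow> lay q = \<delta> + 2"
    and off: "offline V E s \<sigma> T n"
  obtains \<sigma>' h' T' where "\<sigma>' \<in> lists V" "h' \<in> V" "finite T'" "T' \<subseteq> gt h'" "card T' = N"
    "\<forall>q\<in>T'. lay q = \<delta> + 2" "offline V E s \<sigma>' T' (n + (2 * K + \<delta> + 1))"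
    "pot \<theta> T \<sigma> + \<theta> * (gain * K) \<le> pot \<theta> T' \<sigma>'"
proof -
  have TV: "T \<subseteq> V" using T(2) gt_in[OF h] by blast
  obtain u L where u: "u \<in> V" "lay u = \<delta> + 1" "insert u T \<subseteq> gt u" "u \<in> L" "L \<inter> range (alg \<sigma>) = {}"
      "\<forall>x\<in>L. \<delta> < lay x \<and> (\<forall>z. E x z \<longrightarrow> z \<in> L \<or> z \<in> T \<or> lay z \<le> \<delta>)"
    by (rule fresh_A[OF h valid_conf_finite_range[OF valid[OF \<sigma>]] T(1,2), of "{}"]) auto
  have 1: "net {} T \<sigma> \<le> net {u} T \<sigma>"
    using net_activate[of \<sigma> L u "{}" T] \<sigma> u by simp
  have off1: "offline V E s (\<sigma> @ [u]) (insert u T) (n + (\<delta> + 1))"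
    using offline_source[OF off u(1)] u(2) by simp
  have \<sigma>1: "\<sigma> @ [u] \<in> lists V" using \<sigma> u(1) by simp
  have uT: "insert u T \<subseteq> V" using u(1) TV by simp
  obtain \<tau> where \<tau>: "\<tau> \<in> lists (insert u T)" "insert u T \<subseteq> range (alg ((\<sigma> @ [u]) @ \<tau>))"
    by (rule force[OF comp \<sigma>1 uT off1])
  define \<sigma>2 where "\<sigma>2 = \<sigma> @ (u # \<tau>)"
  have \<tau>V: "u # \<tau> \<in> lists V" using \<tau>(1) uT u(1) by auto
  have \<sigma>2: "\<sigma>2 \<in> lists V" using \<sigma> \<tau>V by (simp add: \<sigma>2_def)
  have off2: "offline V E s \<sigma>2 (insert u T) (n + (\<delta> + 1))"
    using offline_requests[OF off1 \<tau>(1)] by (simp add: \<sigma>2_def)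
  have cov: "u \<in> range (alg \<sigma>2)" "T \<subseteq> range (alg \<sigma>2)" using \<tau>(2) by (auto simp: \<sigma>2_def)
  have 2: "net {} T \<sigma> \<le> net {u} T \<sigma>2" "cost \<sigma> \<le> cost \<sigma>2"
    using 1 net_requests[OF \<sigma> \<tau>V, of "{u}" T] cost_mono[of \<sigma> "u # \<tau>"] by (simp_all add: \<sigma>2_def)
  have T4: "\<forall>q\<in>T. lay q = \<delta> + 2" using T(4) by blast
  from steps[OF \<sigma>2 u(1) T(1) u(3) T4 u(2) cov(1) off2, of K]
  obtain \<tau>' h' Y u' where st: "\<tau>' \<in> lists V" "h' \<in> V" "finite Y" "card Y = K" "Y \<inter> T = {}"
     "\<forall>y\<in>Y. lay y = \<delta> + 2" "insert u' (T \<union> Y) \<subseteq> gt h'" "lay u' = \<delta> + 1"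
     "u' \<in> range (alg (\<sigma>2 @ \<tau>'))"
     "\<forall>X\<subseteq>T. card X = K \<longrightarrow>
        offline V E s (\<sigma>2 @ \<tau>') (insert u' (T - X \<union> Y)) (n + (\<delta> + 1) + 2 * K)"
     "net {u} T \<sigma>2 + int K * (2 + decay) \<le> net {u'} (T \<union> Y) (\<sigma>2 @ \<tau>')"
    by (elim exE conjE) (rule that)
  define \<sigma>3 where "\<sigma>3 = \<sigma>2 @ \<tau>'"
  have \<sigma>3: "\<sigma>3 \<in> lists V" using \<sigma>2 st(1) by (simp add: \<sigma>3_def)
  have "\<exists>X\<subseteq>T. card X = K \<and> pot \<theta> T \<sigma> + \<theta> * (gain * K) \<le> pot \<theta> (T - X \<union> Y) \<sigma>3"
  \<comment> \<open>With enough covered nodes, \<open>X\<close> is taken among them, and each falls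
    from weight \<open>\<delta>\<close> to 0. Otherwise more than \<open>N - K\<close> nodes of
    \<open>T\<close> were deserted after having been covered, and the share
    \<open>1 - \<theta>\<close> of that cost makes up for the missing gain.\<close>
  proof (cases "K \<le> card (T \<inter> range (alg \<sigma>3))")
    case True
    then obtain X where X: "X \<subseteq> T \<inter> range (alg \<sigma>3)" "card X = K" by (meson obtain_subset_with_card_n)
    have "s \<notin> X" using X(1) T(4)[of s] lay_s by auto
    moreover have "wt {} (T - X \<union> Y) p + int \<delta> \<le> wt {u'} (T \<union> Y) p" if "p \<in> X" for p
    proof -
      have "p \<in> T" "p \<notin> Y" using that X(1) st(5) by auto
      then show ?thesis using T(4)[of p] that by (simp add: wt_def)
    qed
    moreover have "wt {} (T - X \<union> Y) p \<le> wt {u'} (T \<union> Y) p" for p by (rule wt_mono) auto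
    ultimately have "net {u'} (T \<union> Y) \<sigma>3 + int \<delta> * int (card X) \<le> net {} (T - X \<union> Y) \<sigma>3"
      using X(1) by (intro net_change[OF \<sigma>3]) auto
    then have "net {} T \<sigma> + gain * int K \<le> net {} (T - X \<union> Y) \<sigma>3"
      using 2(1) st(11) X(2) by (simp add: \<sigma>3_def gain_def algebra_simps)
    then have "real_of_int (net {} T \<sigma> + gain * int K) \<le> real_of_int (net {} (T - X \<union> Y) \<sigma>3)"
      by (simp only: of_int_le_iff)
    from mult_left_mono[OF this \<theta>(1)]
    have "\<theta> * real_of_int (net {} T \<sigma> + gain * int K) \<le> \<theta> * real_of_int (net {} (T - X \<union> Y) \<sigma>3)" .
    moreover have "(1 - \<theta>) * cost \<sigma> \<le> (1 - \<theta>) * cost \<sigma>3"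
      using \<theta>(2) 2(2) cost_mono[of \<sigma>2 \<tau>'] by (intro mult_left_mono) (auto simp: \<sigma>3_def)
    ultimately have "pot \<theta> T \<sigma> + \<theta> * (gain * K) \<le> pot \<theta> (T - X \<union> Y) \<sigma>3"
      unfolding pot_def by (simp add: algebra_simps)
    then show ?thesis using X by blast
  next
    case False
    obtain X where X: "X \<subseteq> T" "card X = K" using K(1) T(3) by (metis obtain_subset_with_card_n)
    have "card (T \<inter> range (alg \<sigma>3)) + card (T - range (alg \<sigma>3)) = N"
      using T(1,3) by (metis Int_Diff_Un Int_Diff_disjoint card_Un_disjoint finite_Diff finite_Int)
    then have "N - K \<le> card (T - range (alg \<sigma>3))" using False by simp
    then have "cost \<sigma> + (N - K) \<le> cost \<sigma>3"
      using uncovered_le_cost[OF \<sigma>2 st(1) T(1) cov(2)] 2(2) by (simp add: \<sigma>3_def)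
    then have "real (cost \<sigma>) + real (N - K) \<le> real (cost \<sigma>3)"
      by (metis of_nat_add of_nat_le_iff)
    then have costs: "(1 - \<theta>) * (cost \<sigma> + real (N - K)) \<le> (1 - \<theta>) * cost \<sigma>3"
      using \<theta>(2) by (intro mult_left_mono) auto
    have "net {u'} (T \<union> Y) \<sigma>3 \<le> net {} (T - X \<union> Y) \<sigma>3"
      by (rule net_shrink[OF \<sigma>3]) auto
    moreover have "0 \<le> int K * (2 + decay)" using decay_bounds by simp
    ultimately have "net {} T \<sigma> \<le> net {} (T - X \<union> Y) \<sigma>3"
      using 2(1) st(11) unfolding \<sigma>3_def by linarith
    then have "\<theta> * net {} T \<sigma> \<le> \<theta> * net {} (T - X \<union> Y) \<sigma>3"
      using \<theta>(1) by (intro mult_left_mono) auto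
    then have "pot \<theta> T \<sigma> + \<theta> * (gain * K) \<le> pot \<theta> (T - X \<union> Y) \<sigma>3"
      using costs K(2) unfolding pot_def by (simp add: algebra_simps)
    then show ?thesis using X by blast
  qed
  then obtain X where X: "X \<subseteq> T" "card X = K"
    and p: "pot \<theta> T \<sigma> + \<theta> * (gain * K) \<le> pot \<theta> (T - X \<union> Y) \<sigma>3" by blast
  have "card (T - X \<union> Y) = card (T - X) + card Y"
    using T(1) st(3,5) by (intro card_Un_disjoint) auto
  also have "\<dots> = N" using X T(1,3) st(4) K(1) finite_subset[OF X(1) T(1)] by (simp add: card_Diff_subset)
  finally have card: "card (T - X \<union> Y) = N" .
  have "offline V E s \<sigma>3 (insert u' (T - X \<union> Y)) (n + (\<delta> + 1) + 2 * K)"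
    using st(10) X by (simp add: \<sigma>3_def)
  then have off3: "offline V E s \<sigma>3 (T - X \<union> Y) (n + (2 * K + \<delta> + 1))"
    by (rule offline_mono) auto
  show thesis
    by (rule that[OF \<sigma>3 st(2) _ _ card _ off3 p]) (use T(1,4) st(3,6,7) in auto)
qed

theorem not_competitive:
  assumes "\<rho> < real_of_int gain / 2"
  shows "\<not> competitive V E s alg \<rho>"
proof
  assume "competitive V E s alg \<rho>"
  then obtain c0 where bd: "\<forall>\<sigma>\<in>lists V. real (cost \<sigma>) \<le> \<rho> * real (opt_cost V E s \<sigma>) + c0"
    unfolding competitive_def by blast
  \<comment> \<open>\<open>force\<close> and the monotonicity of multiplication require a
    nonnegative ratio.\<close>
  define r where "r = max \<rho> 0"
  define g where "g = real_of_int gain"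
  have "g \<ge> 2" using decay_bounds by (simp add: g_def gain_def)
  then have r: "0 \<le> r" "r < g / 2" using assms by (auto simp: r_def g_def)
  have c0: "real (cost \<sigma>) \<le> r * real (opt_cost V E s \<sigma>) + c0" if "\<sigma> \<in> lists V" for \<sigma>
  proof -
    have "\<rho> * real (opt_cost V E s \<sigma>) \<le> r * real (opt_cost V E s \<sigma>)"
      by (rule mult_right_mono) (auto simp: r_def)
    then show ?thesis using bspec[OF bd that] by linarith
  qed
  then have comp: "competitive V E s alg r" unfolding competitive_def by blast
  \<comment> \<open>Chosen so that \<open>\<theta> * g\<close> is the midpoint of
    \<open>2 * r\<close> and \<open>g\<close>: the discounted gain per step still exceeds
    \<open>r\<close> times the offline cost 2.\<close>
  define \<theta> where "\<theta> = (2 * r + g) / (2 * g)"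
  have \<theta>: "0 \<le> \<theta>" "\<theta> < 1" "\<theta> * g = r + g / 2"
    using r \<open>g \<ge> 2\<close> by (auto simp: \<theta>_def field_simps)
  \<comment> \<open>So many steps outweigh the opening cost \<open>\<delta> + 1\<close> of an epoch
    and leave a surplus of 1. After that, \<open>M\<close> is the surplus of nodes in
    \<open>T\<close> that makes desertion expensive enough for \<open>epoch\<close>.\<close>
  obtain K :: nat where "(r * (\<delta> + 1) + 1) / (g / 2 - r) < real K" using reals_Archimedean2 by blast
  then have "r * (\<delta> + 1) + 1 < real K * (g / 2 - r)" using r(2) by (simp add: pos_divide_less_eq)
  moreover have "\<theta> * (g * K) = (r + g / 2) * K" unfolding \<theta>(3)[symmetric] by simp
  ultimately have K: "r * (2 * K + \<delta> + 1) + 1 \<le> \<theta> * (g * K)" by (simp add: algebra_simps)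
  obtain M :: nat where "\<theta> * (g * K) / (1 - \<theta>) < real M" using reals_Archimedean2 by blast
  then have M: "\<theta> * (g * K) \<le> (1 - \<theta>) * real M"
    using \<theta>(2) by (simp add: pos_divide_less_eq mult.commute)
  define N where "N = K + M"
  obtain \<sigma>0 h0 T0 where st: "\<sigma>0 \<in> lists V" "h0 \<in> V" "finite T0" "T0 \<subseteq> gt h0" "card T0 = N"
    "\<forall>q\<in>T0. lay q = \<delta> + 2" "offline V E s \<sigma>0 T0 ((\<delta> + 1) + N * (\<delta> + 2))"
    by (rule start[of N])
  define n where "n = (\<delta> + 1) + N * (\<delta> + 2)"
  have ex: "\<exists>\<sigma> h T. \<sigma> \<in> lists V \<and> h \<in> V \<and> finite T \<and> T \<subseteq> gt h \<and> card T = N \<and>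
      (\<forall>q\<in>T. lay q = \<delta> + 2) \<and> offline V E s \<sigma> T (n + m * (2 * K + \<delta> + 1)) \<and>
      pot \<theta> T0 \<sigma>0 + m * (\<theta> * (g * K)) \<le> pot \<theta> T \<sigma>" for m :: nat
  proof (induction m)
    case 0
    show ?case
      by (rule exI[of _ \<sigma>0], rule exI[of _ h0], rule exI[of _ T0]) (use st in \<open>auto simp: n_def\<close>)
  next
    case (Suc m)
    from Suc.IH obtain \<sigma> h T where IH: "\<sigma> \<in> lists V" "h \<in> V" "finite T" "T \<subseteq> gt h" "card T = N"
      "\<forall>q\<in>T. lay q = \<delta> + 2" "offline V E s \<sigma> T (n + m * (2 * K + \<delta> + 1))"
      "pot \<theta> T0 \<sigma>0 + m * (\<theta> * (g * K)) \<le> pot \<theta> T \<sigma>"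
      by (elim exE conjE) (rule that)
    have *: "K \<le> N" "\<theta> * (gain * K) \<le> (1 - \<theta>) * real (N - K)"
      using M by (auto simp: N_def g_def)
    have T: "lay q = \<delta> + 2" if "q \<in> T" for q using IH(6) that by blast
    obtain \<sigma>' h' T' where e: "\<sigma>' \<in> lists V" "h' \<in> V" "finite T'" "T' \<subseteq> gt h'" "card T' = N"
      "\<forall>q\<in>T'. lay q = \<delta> + 2"
      "offline V E s \<sigma>' T' (n + m * (2 * K + \<delta> + 1) + (2 * K + \<delta> + 1))"
      "pot \<theta> T \<sigma> + \<theta> * (gain * K) \<le> pot \<theta> T' \<sigma>'"
      by (rule epoch[OF comp r(1) \<theta>(1) less_imp_le[OF \<theta>(2)] * IH(1-5) T IH(7)])
    have "n + m * (2 * K + \<delta> + 1) + (2 * K + \<delta> + 1) = n + Suc m * (2 * K + \<delta> + 1)" by simp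
    from e(7)[unfolded this] have off: "offline V E s \<sigma>' T' (n + Suc m * (2 * K + \<delta> + 1))" .
    have pot: "pot \<theta> T0 \<sigma>0 + Suc m * (\<theta> * (g * K)) \<le> pot \<theta> T' \<sigma>'"
      using IH(8) e(8) by (simp add: g_def algebra_simps)
    show ?case
      by (rule exI[of _ \<sigma>'], rule exI[of _ h'], rule exI[of _ T']) (use e off pot in auto)
  qed
  obtain m :: nat where m: "r * n + c0 - pot \<theta> T0 \<sigma>0 < real m" using reals_Archimedean2 by blast
  from ex[of m] obtain \<sigma> T where \<sigma>: "\<sigma> \<in> lists V" "offline V E s \<sigma> T (n + m * (2 * K + \<delta> + 1))"
      "pot \<theta> T0 \<sigma>0 + m * (\<theta> * (g * K)) \<le> pot \<theta> T \<sigma>"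
    by (elim exE conjE) (rule that)
  have "pot \<theta> T0 \<sigma>0 + m * (\<theta> * (g * K)) \<le> real (cost \<sigma>)"
    using \<sigma>(3) pot_le_cost[OF \<theta>(1)] by (rule order_trans)
  also have "\<dots> \<le> r * real (opt_cost V E s \<sigma>) + c0" by (rule c0[OF \<sigma>(1)])
  also have "\<dots> \<le> r * real (n + m * (2 * K + \<delta> + 1)) + c0"
    using r(1) opt_cost_le[OF \<sigma>(2)] by (intro add_mono mult_left_mono) (simp_all only: of_nat_le_iff order_refl)
  finally have "pot \<theta> T0 \<sigma>0 + m * (\<theta> * (g * K)) \<le> r * n + m * (r * (2 * K + \<delta> + 1)) + c0"
    by (simp add: algebra_simps)
  moreover have "m * (r * (2 * K + \<delta> + 1) + 1) \<le> m * (\<theta> * (g * K))"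
    by (rule mult_left_mono[OF K]) simp
  ultimately show False using m by (simp add: algebra_simps)
qed

end

section \<open>The graph\<close>

text \<open>
A node \<open>Nd h b i F G\<close> records the previously requested node \<open>h\<close>, whether it lies in layer B, an index
\<open>i\<close> that supplies infinitely many copies, its neighbours \<open>F\<close> at the time of creation, and the set
\<open>G\<close> of earlier nodes to which later nodes of the same history may still be attached. As earlier
nodes can only be lost from \<open>G\<close>, nothing built on top of a fresh node is attached to an abandoned
one, which would shorten the way between the two.
\<close>

datatype node = Root nat | Nd node bool nat "node list" "node list"

instance node :: countable by countable_datatype

fun gates :: "node \<Rightarrow> node set" where
  "gates (Root k) = {}"
| "gates (Nd h b i F G) = set G"

fun level :: "nat \<Rightarrow> node \<Rightarrow> nat" where
  "level \<delta> (Root k) = k"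
| "level \<delta> (Nd h b i F G) = (if b then \<delta> + 2 else \<delta> + 1)"

primrec legal :: "nat \<Rightarrow> node \<Rightarrow> bool" where
  "legal \<delta> (Root k) = (k \<le> \<delta>)"
| "legal \<delta> (Nd h b i F G) = (legal \<delta> h \<and> set F \<subseteq> set G \<and> set G \<subseteq> insert h (gates h) \<and>
     (\<forall>f\<in>set F. level \<delta> f = (if b then \<delta> + 1 else \<delta> + 2)) \<and> (b \<longrightarrow> F \<noteq> []))"

text \<open>For \<open>Nd\<close> the direction is that of creation, not of layers: an A-node points
  to its earlier B-neighbours in \<open>F\<close> as well as to the top \<open>Root \<delta>\<close>
  of the path.\<close>

fun down :: "nat \<Rightarrow> node \<Rightarrow> node \<Rightarrow> bool" where
  "down \<delta> (Root k) z = (0 < k \<and> z = Root (k - 1))"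
| "down \<delta> (Nd h b i F G) z = (z \<in> set F \<or> \<not> b \<and> z = Root \<delta>)"

definition edge :: "nat \<Rightarrow> node \<Rightarrow> node \<Rightarrow> bool" where
  "edge \<delta> x z \<longleftrightarrow> legal \<delta> x \<and> legal \<delta> z \<and> (down \<delta> x z \<or> down \<delta> z x)"

primrec chain :: "node \<Rightarrow> node set" where
  "chain (Root k) = {Root k}"
| "chain (Nd h b i F G) = insert (Nd h b i F G) (chain h)"

lemma chain_self: "x \<in> chain x" and finite_chain: "finite (chain x)"
  by (induction x) auto

lemma legal_gates: "legal \<delta> x \<Longrightarrow> z \<in> gates x \<Longrightarrow> legal \<delta> z \<and> chain z \<subseteq> chain x"
proof (induction x)
  case (Nd h b i F G)
  then have "z = h \<or> z \<in> gates h" "legal \<delta> h" by auto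
  then show ?case using Nd.IH(1) by auto
qed simp

text \<open>Each node in the history keeps only its predecessor and some of the predecessor's gates.
  So a gate of \<open>x\<close> either was a gate of \<open>w\<close> already or has
  \<open>w\<close> in its own history.\<close>

lemma gates_chain:
  "legal \<delta> x \<Longrightarrow> w \<in> chain x \<Longrightarrow> gates x \<subseteq> gates w \<union> {z. legal \<delta> z \<and> w \<in> chain z}"
proof (induction x)
  case (Nd h b i F G)
  show ?case
  proof (cases "w = Nd h b i F G")
    case False
    then have w: "w \<in> chain h" using Nd.prems by auto
    moreover have "legal \<delta> h" "set G \<subseteq> insert h (gates h)" using Nd.prems by auto
    ultimately show ?thesis using Nd.IH(1) by auto
  qed simp
qed auto

lemma layered_graph_nodes: "layered_graph {x. legal \<delta> x} (edge \<delta>) (level \<delta>) (Root 0) (\<delta> + 2)"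
proof -
  have "level \<delta> x \<le> \<delta> + 2" "level \<delta> x = 0 \<longleftrightarrow> x = Root 0" if "legal \<delta> x" for x
    using that by (cases x; simp)+
  moreover have "level \<delta> x = level \<delta> z + 1 \<or> level \<delta> z = level \<delta> x + 1" if "legal \<delta> x" "down \<delta> x z" for x z
    using that by (cases x) (auto split: if_splits)
  moreover have "\<exists>z. edge \<delta> z x \<and> level \<delta> z + 1 = level \<delta> x" if x: "legal \<delta> x" "x \<noteq> Root 0" for x
  proof -
    have "\<exists>z. legal \<delta> z \<and> down \<delta> x z \<and> level \<delta> z + 1 = level \<delta> x"
    proof (cases x)
      case (Root k)
      then show ?thesis using x by auto
    next
      case (Nd h b i F G)
      show ?thesis
      proof (cases b)
        case True
        then obtain f where f: "f \<in> set F" using x Nd by (cases F) auto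
        then have "f \<in> gates x" "level \<delta> f = \<delta> + 1" using x Nd True by auto
        then show ?thesis using legal_gates[OF x(1), of f] Nd True f by (intro exI[of _ f]) simp
      qed (use Nd in \<open>auto intro!: exI[of _ "Root \<delta>"]\<close>)
    qed
    then show ?thesis using x(1) by (auto simp: edge_def)
  qed
  ultimately show ?thesis unfolding layered_graph_def by (auto simp: edge_def)
qed

text \<open>\<open>L\<close> consists of the nodes with \<open>w\<close> in their history. A
  neighbour created later inherits \<open>w\<close>; an earlier one is a gate, hence in
  \<open>L\<close> or \<open>M\<close> by \<open>gates_chain\<close>, or it is
  \<open>Root \<delta>\<close>.\<close>

lemma gadget_nodes:
  assumes "\<delta> \<le> 2"
  shows "gadget {x. legal \<delta> x} (edge \<delta>) (level \<delta>) (Root 0) \<delta> (\<lambda>h. insert h (gates h))"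
proof
  show "layered_graph {x. legal \<delta> x} (edge \<delta>) (level \<delta>) (Root 0) (\<delta> + 2)"
    by (rule layered_graph_nodes)
  show "insert h (gates h) \<subseteq> {x. legal \<delta> x}" if "h \<in> {x. legal \<delta> x}" for h
    using that legal_gates by auto
  fix h :: node and P M F :: "node set" and l :: nat
  assume h: "h \<in> {x. legal \<delta> x}" and fin: "finite P" "finite M" and M: "M \<subseteq> insert h (gates h)"
    and F: "F \<subseteq> M" and l: "l = \<delta> + 1 \<and> (\<forall>f\<in>F. level \<delta> f = \<delta> + 2) \<or>
      l = \<delta> + 2 \<and> F \<noteq> {} \<and> (\<forall>f\<in>F. level \<delta> f = \<delta> + 1)"
  obtain Gl Fl where lists: "set Gl = M" "set Fl = F"
    using finite_list[OF fin(2)] finite_list[OF finite_subset[OF F fin(2)]] by blast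
  define idx where "idx = (\<lambda>x. case x of Root k \<Rightarrow> 0 | Nd h b i F G \<Rightarrow> i)"
  \<comment> \<open>An index that occurs in no history of a node of \<open>P\<close> keeps
    \<open>w\<close> out of all these histories; the default 0 for roots merely excludes one more
    index.\<close>
  have "finite (idx ` (\<Union>p\<in>P. chain p))" using fin(1) finite_chain by blast
  then obtain i where i: "i \<notin> idx ` (\<Union>p\<in>P. chain p)"
    using ex_new_if_finite[OF infinite_UNIV_nat] by blast
  define w where "w = Nd h (l = \<delta> + 2) i Fl Gl"
  define L where "L = {x. legal \<delta> x \<and> w \<in> chain x}"
  have w: "legal \<delta> w" "level \<delta> w = l" "gates w = M" using h M F l lists by (auto simp: w_def)
  have "L \<inter> P = {}"
  proof -
    have "idx w = i" by (simp add: w_def idx_def)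
    then have "w \<notin> (\<Union>p\<in>P. chain p)" using i by blast
    then show ?thesis by (auto simp: L_def)
  qed
  moreover have "\<delta> < level \<delta> x \<and> (\<forall>z. edge \<delta> x z \<longrightarrow> z \<in> L \<or> z \<in> M \<or> level \<delta> z \<le> \<delta>)"
    if x: "x \<in> L" for x
  proof -
    obtain h' b' i' F' G' where xN: "x = Nd h' b' i' F' G'"
      using x by (cases x) (auto simp: L_def w_def)
    have xl: "legal \<delta> x" "w \<in> chain x" using x by (auto simp: L_def)
    have "z \<in> L \<or> z \<in> M \<or> level \<delta> z \<le> \<delta>" if "edge \<delta> x z" for z
    proof -
      have z: "legal \<delta> z" "down \<delta> x z \<or> down \<delta> z x" using that by (auto simp: edge_def)
      show ?thesis
      proof (cases "down \<delta> x z")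
        case True
        then have "z \<in> gates x \<or> z = Root \<delta>" using xN xl(1) by auto
        then show ?thesis using gates_chain[OF xl] w(3) by (auto simp: L_def)
      next
        case False
        then have "x \<in> gates z" using z xN by (cases z) auto
        then show ?thesis using legal_gates[OF z(1)] xl(2) z(1) by (auto simp: L_def)
      qed
    qed
    then show ?thesis using xN by auto
  qed
  moreover have "edge \<delta> f w" if "f \<in> F" for f
    using that w legal_gates[OF w(1), of f] F lists(2) by (auto simp: edge_def w_def)
  moreover have "w \<in> L" using w(1) chain_self by (simp add: L_def)
  ultimately show "\<exists>w L. w \<in> {x. legal \<delta> x} \<and> level \<delta> w = l \<and> insert w M \<subseteq> insert w (gates w) \<and>
      (\<forall>f\<in>F. edge \<delta> f w) \<and> w \<in> L \<and> L \<inter> P = {} \<and>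
      (\<forall>x\<in>L. \<delta> < level \<delta> x \<and> (\<forall>z. edge \<delta> x z \<longrightarrow> z \<in> L \<or> z \<in> M \<or> level \<delta> z \<le> \<delta>))"
    using w by (intro exI[of _ w] exI[of _ L]) simp
qed (use assms in simp)

text \<open>The lower bounds ask for graphs over \<open>nat\<close>, so the gadget on the countable
  type \<open>node\<close> is transported along an injection.\<close>

lemma gadget_image:
  fixes f :: "'a \<Rightarrow> 'b"
  assumes "gadget V E lay s \<delta> gt" and f: "inj f"
  shows "gadget (f ` V) (\<lambda>x y. \<exists>u v. x = f u \<and> y = f v \<and> E u v) (\<lambda>x. lay (inv f x)) (f s) \<delta>
           (\<lambda>x. f ` gt (inv f x))"
proof -
  interpret gadget V E lay s \<delta> gt by (rule assms(1))
  let ?E = "\<lambda>x y. \<exists>u v. x = f u \<and> y = f v \<and> E u v" and ?lay = "\<lambda>x. lay (inv f x)"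
  have inv: "inv f (f x) = x" for x using f by simp
  have eq: "f x = f y \<longleftrightarrow> x = y" for x y using f by (simp add: inj_eq)
  show ?thesis
  proof
    show "layered_graph (f ` V) ?E ?lay (f s) (\<delta> + 2)"
      unfolding layered_graph_def
    proof (intro conjI ballI allI impI)
      fix u v assume "?E u v"
      then obtain x y where xy: "u = f x" "v = f y" "E x y" by blast
      show "?E v u" using xy E_sym by blast
      show "?lay v = ?lay u + 1 \<or> ?lay u = ?lay v + 1" using xy(1,2) E_lay[OF xy(3)] by (simp add: inv)
    next
      fix v assume "v \<in> f ` V" "v \<noteq> f s"
      then obtain x where x: "v = f x" "x \<in> V" "x \<noteq> s" by auto
      then obtain u where "E u x" "lay u + 1 = lay x" using parent by blast
      then show "\<exists>u. ?E u v \<and> ?lay u + 1 = ?lay v" using x(1) by (intro exI[of _ "f u"]) (auto simp: inv)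
    qed (use E_in lay_le lay_0 in \<open>auto simp: inv eq\<close>)
    show "\<delta> \<le> 2" by (rule \<delta>_le)
    show "f ` gt (inv f h) \<subseteq> f ` V" if hV: "h \<in> f ` V" for h
    proof -
      obtain x where "h = f x" "x \<in> V" using hV by blast
      then show ?thesis using image_mono[OF gt_in] by (simp add: inv)
    qed
    fix h :: 'b and P M F :: "'b set" and l :: nat
    assume h: "h \<in> f ` V" and fin: "finite P" "finite M" and M: "M \<subseteq> f ` gt (inv f h)" and F: "F \<subseteq> M"
      and l: "l = \<delta> + 1 \<and> (\<forall>x\<in>F. ?lay x = \<delta> + 2) \<or> l = \<delta> + 2 \<and> F \<noteq> {} \<and> (\<forall>x\<in>F. ?lay x = \<delta> + 1)"
    obtain h' where h': "h = f h'" "h' \<in> V" using h by blast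
    obtain M' where M': "M = f ` M'" "M' \<subseteq> gt h'" using M h'(1) by (auto simp: inv subset_image_iff)
    obtain F' where F': "F = f ` F'" "F' \<subseteq> M'" using F M'(1) by (auto simp: subset_image_iff)
    have fin': "finite (f -` P)" "finite M'"
      using fin f M'(1) by (auto intro: finite_vimageI dest: finite_imageD simp: inj_on_def eq)
    have "l = \<delta> + 1 \<and> (\<forall>x\<in>F'. lay x = \<delta> + 2) \<or> l = \<delta> + 2 \<and> F' \<noteq> {} \<and> (\<forall>x\<in>F'. lay x = \<delta> + 1)"
      using l F'(1) by (simp add: inv)
    from fresh[OF h'(2) fin' M'(2) F'(2) this]
    obtain w L where w: "w \<in> V" "lay w = l" "insert w M' \<subseteq> gt w" "\<forall>x\<in>F'. E x w" "w \<in> L" "L \<inter> f -` P = {}"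
      "\<forall>x\<in>L. \<delta> < lay x \<and> (\<forall>z. E x z \<longrightarrow> z \<in> L \<or> z \<in> M' \<or> lay z \<le> \<delta>)"
      by (elim exE conjE) (rule that)
    show "\<exists>w L. w \<in> f ` V \<and> ?lay w = l \<and> insert w M \<subseteq> f ` gt (inv f w) \<and> (\<forall>x\<in>F. ?E x w) \<and>
        w \<in> L \<and> L \<inter> P = {} \<and>
        (\<forall>x\<in>L. \<delta> < ?lay x \<and> (\<forall>z. ?E x z \<longrightarrow> z \<in> L \<or> z \<in> M \<or> ?lay z \<le> \<delta>))"
    proof (intro exI conjI)
      show "f w \<in> f ` V" "?lay (f w) = l" "f w \<in> f ` L" using w by (auto simp: inv)
      show "insert (f w) M \<subseteq> f ` gt (inv f (f w))" using w(3) M'(1) by (auto simp: inv)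
      show "\<forall>x\<in>F. ?E x (f w)" using w(4) F'(1) by blast
      show "f ` L \<inter> P = {}" using w(6) by auto
      show "\<forall>x\<in>f ` L. \<delta> < ?lay x \<and> (\<forall>z. ?E x z \<longrightarrow> z \<in> f ` L \<or> z \<in> M \<or> ?lay z \<le> \<delta>)"
      proof (intro ballI conjI allI impI)
        fix x assume "x \<in> f ` L"
        then obtain x' where x': "x = f x'" "x' \<in> L" by blast
        then show "\<delta> < ?lay x" using w(7) by (simp add: inv)
        fix z assume "?E x z"
        then obtain z' where "z = f z'" "E x' z'" using x'(1) by (auto simp: eq)
        then show "z \<in> f ` L \<or> z \<in> M \<or> ?lay z \<le> \<delta>" using w(7) x'(2) M'(1) by (auto simp: inv)
      qed
    qed
  qed
qed

section \<open>Lower bounds over the naturals and the final theorem\<close>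

lemma lower_bound:
  assumes "\<delta> \<le> 2" "\<rho> < (2 + (real \<delta> + 1 - real (\<delta> - 1)) + real \<delta>) / 2"
  shows "\<exists>(V::nat set) E lay s. layered_graph V E lay s (\<delta> + 2) \<and>
           (\<forall>alg. online_alg V s alg \<longrightarrow> \<not> competitive V E s alg \<rho>)"
proof -
  have "\<exists>(V::nat set) E lay s gt. gadget V E lay s \<delta> gt"
    using gadget_image[OF gadget_nodes[OF assms(1)] inj_to_nat] by blast
  then obtain V :: "nat set" and E lay s gt where g: "gadget V E lay s \<delta> gt" by blast
  interpret gadget V E lay s \<delta> gt by (rule g)
  have "\<not> competitive V E s alg \<rho>" if "online_alg V s alg" for alg
  proof -
    interpret gadget_alg V E lay s \<delta> gt alg by unfold_locales (rule that)
    show ?thesis by (rule not_competitive) (use assms(2) in \<open>simp add: gain_def decay_def\<close>)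
  qed
  then show ?thesis using lg by blast
qed

text \<open>\<open>D\<close> enters only as an upper bound on the layers. Hence the gadget with
  \<open>\<delta> = 2\<close>, of depth 4, settles every larger depth.\<close>

lemma layered_graph_mono: "layered_graph V E lay s D \<Longrightarrow> D \<le> D' \<Longrightarrow> layered_graph V E lay s D'"
  unfolding layered_graph_def by (elim conjE, intro conjI; (assumption | blast intro: order_trans))

theorem theorem8:
  shows "(\<forall>(V::'v set) E lay s. layered_graph V E lay s 2 \<longrightarrow>
            (\<exists>alg. online_alg V s alg \<and> competitive V E s alg (3/2)))
       \<and> (\<forall>(V::'v set) E lay s. layered_graph V E lay s 3 \<longrightarrow>
            (\<exists>alg. online_alg V s alg \<and> competitive V E s alg (5/2)))
       \<and> (\<forall>\<rho>::real. \<rho> < 3/2 \<longrightarrow> (\<exists>(V::nat set) E lay s. layered_graph V E lay s 2 \<and>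
            (\<forall>alg. online_alg V s alg \<longrightarrow> \<not> competitive V E s alg \<rho>)))
       \<and> (\<forall>\<rho>::real. \<rho> < 5/2 \<longrightarrow> (\<exists>(V::nat set) E lay s. layered_graph V E lay s 3 \<and>
            (\<forall>alg. online_alg V s alg \<longrightarrow> \<not> competitive V E s alg \<rho>)))
       \<and> (\<forall>D::nat. \<forall>\<rho>::real. D \<ge> 4 \<longrightarrow> \<rho> < 3 \<longrightarrow> (\<exists>(V::nat set) E lay s. layered_graph V E lay s D \<and>
            (\<forall>alg. online_alg V s alg \<longrightarrow> \<not> competitive V E s alg \<rho>)))"
proof (intro conjI allI impI)
  show "\<exists>alg. online_alg V s alg \<and> competitive V E s alg (3/2)"
    if "layered_graph V E lay s 2" for V :: "'v set" and E lay s
  proof -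
    interpret layered V E lay s 2 by unfold_locales (rule that)
    show ?thesis using online_fresh_alg fresh_alg_competitive by auto
  qed
  show "\<exists>alg. online_alg V s alg \<and> competitive V E s alg (5/2)"
    if "layered_graph V E lay s 3" for V :: "'v set" and E lay s
  proof -
    interpret layered V E lay s 3 by unfold_locales (rule that)
    show ?thesis using online_fresh_alg fresh_alg_competitive by auto
  qed
  show "\<exists>(V::nat set) E lay s. layered_graph V E lay s 2 \<and>
      (\<forall>alg. online_alg V s alg \<longrightarrow> \<not> competitive V E s alg \<rho>)" if "\<rho> < 3/2" for \<rho> :: real
    using lower_bound[of 0 \<rho>] that by (simp add: numeral_2_eq_2)
  show "\<exists>(V::nat set) E lay s. layered_graph V E lay s 3 \<and>
      (\<forall>alg. online_alg V s alg \<longrightarrow> \<not> competitive V E s alg \<rho>)" if "\<rho> < 5/2" for \<rho> :: real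
    using lower_bound[of 1 \<rho>] that by (simp add: numeral_3_eq_3)
  show "\<exists>(V::nat set) E lay s. layered_graph V E lay s D \<and>
      (\<forall>alg. online_alg V s alg \<longrightarrow> \<not> competitive V E s alg \<rho>)"
    if "4 \<le> D" "\<rho> < 3" for D and \<rho> :: real
  proof -
    have "\<exists>(V::nat set) E lay s. layered_graph V E lay s (2 + 2) \<and>
        (\<forall>alg. online_alg V s alg \<longrightarrow> \<not> competitive V E s alg \<rho>)"
      by (rule lower_bound) (use \<open>\<rho> < 3\<close> in auto)
    then obtain V :: "nat set" and E lay s where "layered_graph V E lay s (2 + 2)"
        "\<forall>alg. online_alg V s alg \<longrightarrow> \<not> competitive V E s alg \<rho>"
      by blast
    moreover from this(1) have "layered_graph V E lay s D"
      by (rule layered_graph_mono) (use \<open>4 \<le> D\<close> in simp)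
    ultimately show ?thesis by blast
  qed
qed

end
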